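(* Let $0 \to A \to E \to B \to 0$ be an extension (short exact sequence) of $C^*$-algebras. Then \[ \max\{\operatorname{rr}(A),\operatorname{rr}(B)\} \leq \operatorname{rr}(E) \leq \operatorname{rr}(A) + \operatorname{rr}(B) + 1 . \]
   Context: For a unital $C^*$-algebra $D$, let $D_{\mathrm{sa}}$ be its set of self-adjoint elements and let $\operatorname{Lg}_n(D)_{\mathrm{sa}}$ be the set of tuples $(a_1,\ldots,a_n)\in (D_{\mathrm{sa}})^n$ such that $\sum_{k=1}^n a_k^2$ is invertible in $D$ (the zero algebra is regarded as unital, with $0=1$ invertible). The real rank $\operatorname{rr}(D)$ is the least integer $n\geq 0$ such that $\operatorname{Lg}_{n+1}(D)_{\mathrm{sa}}$ is dense in $(D_{\mathrm{sa}})^{n+1}$, and $\operatorname{rr}(D)=\infty$ if there is no such $n$. If $D$ is nonunital, $\operatorname{rr}(D):=\operatorname{rr}(\widetilde{D})$, where $\widetilde{D}$ is the minimal unitization. An extension $0 \to A \to E \to B \to 0$ means that $E$ is a $C^*$-algebra containing (a copy of) $A$ as a closed two-sided ideal with $E/A\cong B$. *)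

theory Defs
  imports "HOL-Analysis.Analysis" "HOL-Library.Extended_Nat"
begin

section \<open>C*-algebras\<close>

text \<open>
  Algebras need not be unital, and the one-point type is a legitimate instance (the zero algebra).
  Homomorphisms are purely algebraic: continuity of \<open>*\<close>-homomorphisms is automatic.
\<close>

class scaleC =
  fixes scaleC :: "complex \<Rightarrow> 'a \<Rightarrow> 'a"  (infixr "*\<^sub>C" 75)

class star =
  fixes star :: "'a \<Rightarrow> 'a"

class cstar_algebra = real_normed_algebra + banach + scaleC + star +
  assumes scaleR_scaleC: "r *\<^sub>R x = complex_of_real r *\<^sub>C x"
    and scaleC_add_right: "c *\<^sub>C (x + y) = c *\<^sub>C x + c *\<^sub>C y"
    and scaleC_add_left: "(c + d) *\<^sub>C x = c *\<^sub>C x + d *\<^sub>C x"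
    and scaleC_scaleC: "c *\<^sub>C d *\<^sub>C x = (c * d) *\<^sub>C x"
    and mult_scaleC_left: "(c *\<^sub>C x) * y = c *\<^sub>C (x * y)"
    and mult_scaleC_right: "x * (c *\<^sub>C y) = c *\<^sub>C (x * y)"
    and norm_scaleC: "norm (c *\<^sub>C x) = cmod c * norm x"
    and star_add: "star (x + y) = star x + star y"
    and star_scaleC: "star (c *\<^sub>C x) = cnj c *\<^sub>C star x"
    and star_mult: "star (x * y) = star y * star x"
    and star_star: "star (star x) = x"
    and norm_star_mult_self: "norm (star x * x) = (norm x)\<^sup>2"

definition star_hom :: "('a::cstar_algebra \<Rightarrow> 'b::cstar_algebra) \<Rightarrow> bool" where
  "star_hom f \<longleftrightarrow>
     (\<forall>x y. f (x + y) = f x + f y) \<and> (\<forall>c x. f (c *\<^sub>C x) = c *\<^sub>C f x) \<and>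
     (\<forall>x y. f (x * y) = f x * f y) \<and> (\<forall>x. f (star x) = star (f x))"

text \<open>
  Short exact sequences \<open>0 \<rightarrow> A \<rightarrow> E \<rightarrow> B \<rightarrow> 0\<close>, with \<open>A\<close>, \<open>E\<close>, \<open>B\<close> the types of the elements.
\<close>

definition cstar_extension ::
  "('a::cstar_algebra \<Rightarrow> 'e::cstar_algebra) \<Rightarrow> ('e \<Rightarrow> 'b::cstar_algebra) \<Rightarrow> bool" where
  "cstar_extension \<iota> \<pi> \<longleftrightarrow>
     star_hom \<iota> \<and> star_hom \<pi> \<and> inj \<iota> \<and> range \<iota> = {x. \<pi> x = 0} \<and> surj \<pi>"

definition is_identity :: "'a::cstar_algebra \<Rightarrow> bool" where
  "is_identity e \<longleftrightarrow> (\<forall>x. e * x = x \<and> x * e = x)"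

definition unital :: "'a::cstar_algebra itself \<Rightarrow> bool" where
  "unital _ \<longleftrightarrow> (\<exists>e::'a. is_identity e)"

definition is_invertible :: "'a::cstar_algebra \<Rightarrow> bool" where
  "is_invertible x \<longleftrightarrow> (\<exists>y. is_identity (x * y) \<and> is_identity (y * x))"

definition self_adjoints :: "'a::cstar_algebra set" where
  "self_adjoints = {a. star a = a}"

lemma scaleC_one [simp]: "1 *\<^sub>C x = (x::'a::cstar_algebra)"
  using scaleR_scaleC[of 1 x] by simp

lemma scaleC_zero_left [simp]: "0 *\<^sub>C x = (0::'a::cstar_algebra)"
  using scaleR_scaleC[of 0 x] by simp

lemma scaleC_zero_right [simp]: "c *\<^sub>C 0 = (0::'a::cstar_algebra)"
  using scaleC_add_right[of c 0 0] by simp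

lemma star_zero [simp]: "star 0 = (0::'a::cstar_algebra)"
  using star_add[of 0 0] by simp

lemma scaleC_minus_right: "c *\<^sub>C (- x) = - (c *\<^sub>C (x::'a::cstar_algebra))"
  using scaleC_add_right[of c x "- x"] by (simp add: eq_neg_iff_add_eq_0 add.commute)

lemma scaleC_minus_left: "(- c) *\<^sub>C x = - (c *\<^sub>C (x::'a::cstar_algebra))"
  using scaleC_add_left[of c "- c" x] by (simp add: eq_neg_iff_add_eq_0 add.commute)

lemma norm_star: "norm (star x) = norm (x::'a::cstar_algebra)"
proof -
  have le: "norm y \<le> norm (star y)" for y :: 'a
  proof (cases "y = 0")
    case False
    have "norm y * norm y \<le> norm (star y) * norm y"
      using norm_star_mult_self[of y] norm_mult_ineq[of "star y" y] by (simp add: power2_eq_square)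
    then show ?thesis using False by simp
  qed simp
  show ?thesis using le[of x] le[of "star x"] by (simp add: star_star)
qed


section \<open>The minimal unitization\<close>

text \<open>
  \<open>Unitization a c\<close> stands for \<open>a + c 1\<close>. It acts on the original algebra by left multiplication,
  and if that algebra is nonunital, the operator norm of this action is the C*-norm on the
  unitization. The maximum with \<open>cmod c\<close> changes nothing in that case (lemma
  \<open>norm_unitization_nonunital\<close> below), and it makes the formula a C*-norm also when the
  algebra has a unit, as the type class instance requires.
\<close>

datatype 'a unitization = Unitization (algebra_part: 'a) (scalar_part: complex)

definition unitization_act :: "'a::cstar_algebra unitization \<Rightarrow> 'a \<Rightarrow> 'a" where
  "unitization_act p b = algebra_part p * b + scalar_part p *\<^sub>C b"

definition unitization_opnorm :: "'a::cstar_algebra unitization \<Rightarrow> real" where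
  "unitization_opnorm p = (SUP b \<in> cball 0 1. norm (unitization_act p b))"

instantiation unitization :: (cstar_algebra) "{zero, plus, minus, uminus, times, scaleR, scaleC, star, norm}"
begin

definition "0 = Unitization 0 0"
definition "p + q = Unitization (algebra_part p + algebra_part q) (scalar_part p + scalar_part q)"
definition "p - q = Unitization (algebra_part p - algebra_part q) (scalar_part p - scalar_part q)"
definition "- p = Unitization (- algebra_part p) (- scalar_part p)"
definition "p * q = Unitization
  (algebra_part p * algebra_part q + scalar_part q *\<^sub>C algebra_part p + scalar_part p *\<^sub>C algebra_part q)
  (scalar_part p * scalar_part q)"
definition "r *\<^sub>R p = Unitization (r *\<^sub>R algebra_part p) (r *\<^sub>R scalar_part p)"
definition "c *\<^sub>C p = Unitization (c *\<^sub>C algebra_part p) (c * scalar_part p)"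
definition "star p = Unitization (star (algebra_part p)) (cnj (scalar_part p))"
definition "norm p = max (cmod (scalar_part p)) (unitization_opnorm p)"

instance ..

end

lemmas unitization_defs = zero_unitization_def plus_unitization_def minus_unitization_def
  uminus_unitization_def times_unitization_def scaleR_unitization_def scaleC_unitization_def
  star_unitization_def

lemma unitization_act_bound:
  "norm (unitization_act p b) \<le> (norm (algebra_part p) + cmod (scalar_part p)) * norm b"
proof -
  have "norm (unitization_act p b) \<le> norm (algebra_part p * b) + norm (scalar_part p *\<^sub>C b)"
    unfolding unitization_act_def by (rule norm_triangle_ineq)
  also have "\<dots> \<le> norm (algebra_part p) * norm b + cmod (scalar_part p) * norm b"
    by (simp add: norm_mult_ineq norm_scaleC)
  finally show ?thesis by (simp add: distrib_right)
qed

lemma unitization_opnorm_bdd: "bdd_above ((\<lambda>b. norm (unitization_act p b)) ` cball 0 1)"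
proof (rule bdd_aboveI2)
  fix b :: 'a assume "b \<in> cball 0 1"
  then show "norm (unitization_act p b) \<le> norm (algebra_part p) + cmod (scalar_part p)"
    using order_trans[OF unitization_act_bound mult_left_le] by (auto simp: add_nonneg_nonneg)
qed

lemma unitization_opnorm_upper:
  "norm b \<le> 1 \<Longrightarrow> norm (unitization_act p b) \<le> unitization_opnorm p"
  unfolding unitization_opnorm_def by (rule cSUP_upper[OF _ unitization_opnorm_bdd]) simp

lemma unitization_opnorm_least:
  "(\<And>b. norm b \<le> 1 \<Longrightarrow> norm (unitization_act p b) \<le> C) \<Longrightarrow> unitization_opnorm p \<le> C"
  unfolding unitization_opnorm_def by (rule cSUP_least) auto

lemma unitization_opnorm_nonneg: "0 \<le> unitization_opnorm p"
  using order_trans[OF norm_ge_zero unitization_opnorm_upper[of 0 p]] by simp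

lemma unitization_act_scaleR: "unitization_act p (r *\<^sub>R b) = r *\<^sub>R unitization_act p b"
  by (simp add: unitization_act_def scaleR_scaleC scaleC_add_right scaleC_scaleC mult_scaleC_right
      mult.commute)

lemma unitization_opnorm_mult:
  "norm (unitization_act p b) \<le> unitization_opnorm p * norm b"
proof (cases "b = 0")
  case True
  then show ?thesis by (simp add: unitization_act_def)
next
  case False
  have "norm (unitization_act p ((1 / norm b) *\<^sub>R b)) \<le> unitization_opnorm p"
    by (rule unitization_opnorm_upper) (simp add: False)
  then show ?thesis using False by (simp add: unitization_act_scaleR field_simps)
qed

lemma unitization_act_times:
  "unitization_act (p * q) b = unitization_act p (unitization_act q b)"
  by (simp add: unitization_act_def unitization_defs algebra_simps scaleC_add_right
      mult_scaleC_left mult_scaleC_right scaleC_scaleC)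

lemma unitization_act_plus:
  "unitization_act (p + q) b = unitization_act p b + unitization_act q b"
  by (simp add: unitization_act_def unitization_defs algebra_simps scaleC_add_left)

lemma unitization_act_scaleC:
  "unitization_act (c *\<^sub>C p) b = c *\<^sub>C unitization_act p b"
  by (simp add: unitization_act_def unitization_defs scaleC_add_right mult_scaleC_left scaleC_scaleC)

lemma unitization_opnorm_triangle:
  "unitization_opnorm (p + q) \<le> unitization_opnorm p + unitization_opnorm q"
  by (rule unitization_opnorm_least)
    (auto simp: unitization_act_plus intro!: norm_triangle_le add_mono unitization_opnorm_upper)

lemma unitization_opnorm_times:
  "unitization_opnorm (p * q) \<le> unitization_opnorm p * unitization_opnorm q"
proof (rule unitization_opnorm_least)
  fix b :: 'a assume b: "norm b \<le> 1"
  have "norm (unitization_act (p * q) b) \<le> unitization_opnorm p * norm (unitization_act q b)"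
    by (simp add: unitization_act_times unitization_opnorm_mult)
  also have "\<dots> \<le> unitization_opnorm p * unitization_opnorm q"
    by (intro mult_left_mono unitization_opnorm_upper b unitization_opnorm_nonneg)
  finally show "norm (unitization_act (p * q) b) \<le> unitization_opnorm p * unitization_opnorm q" .
qed

lemma unitization_opnorm_scaleC_le:
  "unitization_opnorm (c *\<^sub>C p) \<le> cmod c * unitization_opnorm p"
  by (rule unitization_opnorm_least)
    (auto simp: unitization_act_scaleC norm_scaleC intro!: mult_left_mono unitization_opnorm_upper)

lemma unitization_opnorm_scaleC:
  "unitization_opnorm (c *\<^sub>C p) = cmod c * unitization_opnorm p"
proof (cases "c = 0")
  case True
  then show ?thesis
    using unitization_opnorm_scaleC_le[of c p] unitization_opnorm_nonneg[of "c *\<^sub>C p"] by simp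
next
  case False
  have "inverse c *\<^sub>C c *\<^sub>C p = p"
    using False by (cases p) (simp add: scaleC_unitization_def scaleC_scaleC mult.assoc[symmetric])
  then have "unitization_opnorm p \<le> inverse (cmod c) * unitization_opnorm (c *\<^sub>C p)"
    using unitization_opnorm_scaleC_le[of "inverse c" "c *\<^sub>C p"] by (simp add: norm_inverse)
  then show ?thesis
    using False unitization_opnorm_scaleC_le[of c p] by (simp add: field_simps)
qed

lemma star_mult_unitization_act:
  "star (unitization_act p b) * x = star b * unitization_act (star p) x"
  by (simp add: unitization_act_def unitization_defs star_add star_mult star_scaleC algebra_simps
      mult_scaleC_left mult_scaleC_right)

lemma unitization_opnorm_star_self_ge:
  "(unitization_opnorm p)\<^sup>2 \<le> unitization_opnorm (star p * p)"
proof -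
  have "norm (unitization_act p b) \<le> sqrt (unitization_opnorm (star p * p))" if b: "norm b \<le> 1" for b
  proof (rule real_le_rsqrt)
    have "(norm (unitization_act p b))\<^sup>2 = norm (star b * unitization_act (star p * p) b)"
      by (simp add: norm_star_mult_self[symmetric] star_mult_unitization_act unitization_act_times)
    also have "\<dots> \<le> norm b * norm (unitization_act (star p * p) b)"
      using norm_mult_ineq[of "star b"] by (simp add: norm_star)
    also have "\<dots> \<le> 1 * unitization_opnorm (star p * p)"
      by (intro mult_mono b unitization_opnorm_upper) auto
    finally show "(norm (unitization_act p b))\<^sup>2 \<le> unitization_opnorm (star p * p)" by simp
  qed
  then have "unitization_opnorm p \<le> sqrt (unitization_opnorm (star p * p))"
    by (rule unitization_opnorm_least)
  then show ?thesis
    using sqrt_ge_absD unitization_opnorm_nonneg[of p] by (metis abs_of_nonneg)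
qed

lemma star_star_unitization: "star (star p) = (p :: 'a::cstar_algebra unitization)"
  by (simp add: star_unitization_def star_star)

lemma unitization_opnorm_star_self:
  "unitization_opnorm (star p * p) = (unitization_opnorm p)\<^sup>2"
proof -
  have le: "unitization_opnorm q \<le> unitization_opnorm (star q)" for q :: "'a unitization"
  proof (cases "unitization_opnorm q = 0")
    case True
    then show ?thesis by (simp add: unitization_opnorm_nonneg)
  next
    case False
    have "unitization_opnorm q * unitization_opnorm q \<le> unitization_opnorm (star q) * unitization_opnorm q"
      using order_trans[OF unitization_opnorm_star_self_ge unitization_opnorm_times[of "star q" q]]
      by (simp add: power2_eq_square)
    then show ?thesis using False unitization_opnorm_nonneg[of q] by simp
  qed
  have "unitization_opnorm (star p) = unitization_opnorm p"
    using le[of p] le[of "star p"] by (simp add: star_star_unitization)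
  then show ?thesis
    using unitization_opnorm_times[of "star p" p] unitization_opnorm_star_self_ge[of p]
    by (simp add: power2_eq_square)
qed

lemma unitization_opnorm_algebra:
  "unitization_opnorm (Unitization a 0) = norm a"
proof (rule antisym)
  show "unitization_opnorm (Unitization a 0) \<le> norm a"
  proof (rule unitization_opnorm_least)
    fix b :: 'a assume "norm b \<le> 1"
    then show "norm (unitization_act (Unitization a 0) b) \<le> norm a"
      using norm_mult_ineq[of a b] mult_left_le[of "norm b" "norm a"]
      by (simp add: unitization_act_def)
  qed
next
  have "norm a * norm a = norm (unitization_act (Unitization a 0) (star a))"
    using norm_star_mult_self[of "star a"]
    by (simp add: unitization_act_def star_star norm_star power2_eq_square)
  also have "\<dots> \<le> unitization_opnorm (Unitization a 0) * norm a"
    using unitization_opnorm_mult[of _ "star a"] by (simp add: norm_star)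
  finally show "norm a \<le> unitization_opnorm (Unitization a 0)"
    by (cases "a = 0") (auto simp: unitization_opnorm_nonneg)
qed

instantiation unitization :: (cstar_algebra) real_normed_vector
begin

definition "dist p q = norm (p - q :: 'a unitization)"
definition "sgn p = (p :: 'a unitization) /\<^sub>R norm p"
definition [code del]:
  "(uniformity :: ('a unitization \<times> 'a unitization) filter) =
     (INF e\<in>{0 <..}. principal {(x, y). dist x y < e})"
definition [code del]:
  "open (U :: 'a unitization set) \<longleftrightarrow>
     (\<forall>x\<in>U. eventually (\<lambda>(x', y). x' = x \<longrightarrow> y \<in> U) uniformity)"

lemma norm_Unitization_0: "norm (Unitization (a::'a) 0) = norm a"
  by (simp add: norm_unitization_def unitization_opnorm_algebra)

lemma norm_unitization_ge_scalar: "cmod (scalar_part (p::'a unitization)) \<le> norm p"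
  by (simp add: norm_unitization_def)

instance
proof
  fix p q r :: "'a unitization" and c d :: real
  show "p + q + r = p + (q + r)" "p + q = q + p" "0 + p = p" "- p + p = 0" "p - q = p + - q"
    by (simp_all add: unitization_defs unitization.expand)
  show "c *\<^sub>R (p + q) = c *\<^sub>R p + c *\<^sub>R q" "(c + d) *\<^sub>R p = c *\<^sub>R p + d *\<^sub>R p"
    "c *\<^sub>R d *\<^sub>R p = (c * d) *\<^sub>R p" "1 *\<^sub>R p = p"
    by (simp_all add: unitization_defs algebra_simps)
  show "dist p q = norm (p - q)" "sgn p = p /\<^sub>R norm p"
    "(uniformity :: ('a unitization \<times> 'a unitization) filter) =
       (INF e\<in>{0 <..}. principal {(x, y). dist x y < e})"
    "open U \<longleftrightarrow> (\<forall>x\<in>U. eventually (\<lambda>(x', y). x' = x \<longrightarrow> y \<in> U) uniformity)"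
    for U :: "'a unitization set"
    by (rule dist_unitization_def sgn_unitization_def uniformity_unitization_def
        open_unitization_def)+
  show "norm p = 0 \<longleftrightarrow> p = 0"
  proof
    assume "norm p = 0"
    moreover from this have "scalar_part p = 0"
      using norm_unitization_ge_scalar[of p] by simp
    ultimately show "p = 0"
      using norm_Unitization_0[of "algebra_part p"]
      by (cases p) (simp add: zero_unitization_def)
  qed (simp add: zero_unitization_def norm_Unitization_0)
  show "norm (p + q) \<le> norm p + norm q"
    using unitization_opnorm_triangle[of p q] norm_triangle_ineq[of "scalar_part p" "scalar_part q"]
    by (auto simp: norm_unitization_def plus_unitization_def)
  have "c *\<^sub>R p = complex_of_real c *\<^sub>C p"
    by (simp add: unitization_defs scaleR_scaleC scaleR_conv_of_real)
  then show "norm (c *\<^sub>R p) = \<bar>c\<bar> * norm p"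
    using unitization_opnorm_scaleC[of "complex_of_real c" p]
    by (simp add: norm_unitization_def max_mult_distrib_left)
       (simp add: scaleC_unitization_def norm_mult)
qed

end

instance unitization :: (cstar_algebra) cstar_algebra
proof
  fix p q r :: "'a unitization" and c d :: complex and s :: real
  show "p * q * r = p * (q * r)"
    by (simp add: unitization_defs algebra_simps scaleC_add_right mult_scaleC_left mult_scaleC_right
        scaleC_scaleC)
  show "(p + q) * r = p * r + q * r" "p * (q + r) = p * q + p * r"
    by (simp_all add: unitization_defs algebra_simps scaleC_add_right scaleC_add_left)
  show "(s *\<^sub>R p) * q = s *\<^sub>R (p * q)" "p * (s *\<^sub>R q) = s *\<^sub>R (p * q)"
    by (simp_all add: unitization_defs scaleR_scaleC scaleR_conv_of_real scaleC_add_right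
        scaleC_scaleC mult_scaleC_left mult_scaleC_right mult.commute mult.left_commute)
  show "norm (p * q) \<le> norm p * norm q"
  proof -
    have "cmod (scalar_part p) * cmod (scalar_part q) \<le> norm p * norm q"
      by (intro mult_mono) (auto simp: norm_unitization_def le_max_iff_disj)
    moreover have "unitization_opnorm p * unitization_opnorm q \<le> norm p * norm q"
      by (intro mult_mono) (auto simp: norm_unitization_def unitization_opnorm_nonneg
          le_max_iff_disj)
    moreover have "cmod (scalar_part (p * q)) = cmod (scalar_part p) * cmod (scalar_part q)"
      by (simp add: times_unitization_def norm_mult)
    ultimately show ?thesis
      using unitization_opnorm_times[of p q] unfolding norm_unitization_def[of "p * q"] by linarith
  qed
  show "s *\<^sub>R p = complex_of_real s *\<^sub>C p"
    by (simp add: unitization_defs scaleR_scaleC scaleR_conv_of_real)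
  show "c *\<^sub>C (p + q) = c *\<^sub>C p + c *\<^sub>C q" "(c + d) *\<^sub>C p = c *\<^sub>C p + d *\<^sub>C p"
    "c *\<^sub>C d *\<^sub>C p = (c * d) *\<^sub>C p"
    by (simp_all add: unitization_defs scaleC_add_right scaleC_add_left scaleC_scaleC algebra_simps)
  show "(c *\<^sub>C p) * q = c *\<^sub>C (p * q)" "p * (c *\<^sub>C q) = c *\<^sub>C (p * q)"
    by (simp_all add: unitization_defs scaleC_add_right scaleC_scaleC mult_scaleC_left
        mult_scaleC_right mult.commute mult.left_commute)
  show "norm (c *\<^sub>C p) = cmod c * norm p"
    using unitization_opnorm_scaleC[of c p]
    by (simp add: norm_unitization_def max_mult_distrib_left)
       (simp add: scaleC_unitization_def norm_mult)
  show "star (p + q) = star p + star q" "star (c *\<^sub>C p) = cnj c *\<^sub>C star p"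
    "star (p * q) = star q * star p" "star (star p) = p"
    by (simp_all add: unitization_defs star_add star_scaleC star_mult star_star algebra_simps)
  show "norm (star p * p) = (norm p)\<^sup>2"
  proof -
    have "cmod (scalar_part (star p * p)) = (cmod (scalar_part p))\<^sup>2"
      by (simp add: unitization_defs norm_mult power2_eq_square)
    moreover have "max (x\<^sup>2) (y\<^sup>2) = (max x y)\<^sup>2" if "0 \<le> x" "0 \<le> y" for x y :: real
      using that by (auto simp: max_def)
    ultimately show ?thesis
      by (simp add: norm_unitization_def unitization_opnorm_star_self unitization_opnorm_nonneg)
  qed
next
  fix X :: "nat \<Rightarrow> 'a unitization"
  assume X: "Cauchy X"
  define a where "a n = algebra_part (X n)" for n
  define c where "c n = scalar_part (X n)" for n
  have norm_le: "norm p \<le> norm (algebra_part p) + cmod (scalar_part p)" for p :: "'a unitization"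
  proof -
    have "unitization_opnorm p \<le> norm (algebra_part p) + cmod (scalar_part p)"
    proof (rule unitization_opnorm_least)
      fix b :: 'a assume "norm b \<le> 1"
      then show "norm (unitization_act p b) \<le> norm (algebra_part p) + cmod (scalar_part p)"
        using order_trans[OF unitization_act_bound mult_left_le] by (auto simp: add_nonneg_nonneg)
    qed
    then show ?thesis by (simp add: norm_unitization_def)
  qed
  have one: "norm (Unitization 0 d :: 'a unitization) \<le> cmod d" for d
    using norm_le[of "Unitization 0 d"] by simp
  have alg_le: "norm (algebra_part p) \<le> 2 * norm p" for p :: "'a unitization"
  proof -
    have "Unitization (algebra_part p) 0 = p - Unitization 0 (scalar_part p)"
      by (simp add: minus_unitization_def)
    then have "norm (algebra_part p) \<le> norm p + norm (Unitization 0 (scalar_part p) :: 'a unitization)"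
      by (metis norm_Unitization_0 norm_triangle_ineq4)
    then show ?thesis using one[of "scalar_part p"] norm_unitization_ge_scalar[of p] by linarith
  qed
  have "Cauchy c"
  proof (rule metric_CauchyI)
    fix e :: real assume "0 < e"
    then obtain M where M: "\<And>m n. m \<ge> M \<Longrightarrow> n \<ge> M \<Longrightarrow> dist (X m) (X n) < e"
      using metric_CauchyD[OF X] by blast
    have "dist (c m) (c n) < e" if "m \<ge> M" "n \<ge> M" for m n
      using M[OF that] norm_unitization_ge_scalar[of "X m - X n"]
      by (simp add: dist_norm c_def minus_unitization_def)
    then show "\<exists>M. \<forall>m\<ge>M. \<forall>n\<ge>M. dist (c m) (c n) < e" by blast
  qed
  moreover have "Cauchy a"
  proof (rule metric_CauchyI)
    fix e :: real assume "0 < e"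
    then obtain M where M: "\<And>m n. m \<ge> M \<Longrightarrow> n \<ge> M \<Longrightarrow> dist (X m) (X n) < e / 2"
      using metric_CauchyD[OF X, of "e / 2"] by auto
    have "dist (a m) (a n) < e" if "m \<ge> M" "n \<ge> M" for m n
      using M[OF that] alg_le[of "X m - X n"]
      by (simp add: dist_norm a_def minus_unitization_def)
    then show "\<exists>M. \<forall>m\<ge>M. \<forall>n\<ge>M. dist (a m) (a n) < e" by blast
  qed
  ultimately obtain a' c' where lim: "a \<longlonglongrightarrow> a'" "c \<longlonglongrightarrow> c'"
    using Cauchy_convergent convergent_def by metis
  have "(\<lambda>n. norm (a n - a') + cmod (c n - c')) \<longlonglongrightarrow> norm (a' - a') + cmod (c' - c')"
    by (intro tendsto_intros lim)
  then have null: "(\<lambda>n. norm (a n - a') + cmod (c n - c')) \<longlonglongrightarrow> 0" by simp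
  have "norm (X n - Unitization a' c') \<le> norm (a n - a') + cmod (c n - c')" for n
    using norm_le[of "X n - Unitization a' c'"] by (simp add: minus_unitization_def a_def c_def)
  then have "(\<lambda>n. X n - Unitization a' c') \<longlonglongrightarrow> 0"
    by (intro Lim_null_comparison[OF _ null] always_eventually allI)
  then show "convergent X"
    unfolding convergent_def using LIM_zero_iff by blast
qed

lemma is_identity_unitization: "is_identity (Unitization 0 1 :: 'a::cstar_algebra unitization)"
  by (simp add: is_identity_def times_unitization_def)

lemma left_identity_imp_identity:
  fixes e :: "'a::cstar_algebra"
  assumes "\<And>x. e * x = x"
  shows "is_identity e"
proof -
  have r: "x * star e = x" for x
    using arg_cong[OF assms[of "star x"], of star] by (simp add: star_mult star_star)
  then have "star e = e" using assms[of "star e"] r[of e] by simp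
  then show ?thesis using assms r by (simp add: is_identity_def)
qed

lemma norm_unitization_nonunital:
  fixes p :: "'a::cstar_algebra unitization"
  assumes "\<not> unital TYPE('a)"
  shows "norm p = (SUP b \<in> cball 0 1. norm (algebra_part p * b + scalar_part p *\<^sub>C b))"
proof -
  have "cmod (scalar_part p) \<le> unitization_opnorm p"
  proof (rule ccontr)
    assume "\<not> cmod (scalar_part p) \<le> unitization_opnorm p"
    then have less: "unitization_opnorm p < cmod (scalar_part p)" by simp
    then have nz: "scalar_part p \<noteq> 0" using unitization_opnorm_nonneg[of p] by auto
    define x where "x = inverse (scalar_part p) *\<^sub>C algebra_part p"
    define q where "q = unitization_opnorm p / cmod (scalar_part p)"
    have q: "0 \<le> q" "q < 1"
      using less nz unitization_opnorm_nonneg[of p] by (auto simp: q_def)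
    have contr: "norm (b + x * b) \<le> q * norm b" for b
    proof -
      have "b + x * b = inverse (scalar_part p) *\<^sub>C unitization_act p b"
        using nz by (simp add: x_def unitization_act_def scaleC_add_right scaleC_scaleC
            mult_scaleC_left)
      then show ?thesis
        using unitization_opnorm_mult[of p b] nz
        by (simp add: norm_scaleC norm_inverse norm_divide q_def field_simps)
    qed
    have "inj (\<lambda>b. x * b)"
    proof (rule injI)
      fix b d assume "x * b = x * d"
      then have "norm (b - d) \<le> q * norm (b - d)"
        using contr[of "b - d"] by (simp add: right_diff_distrib)
      then show "b = d" using q mult_le_cancel_right1[of "norm (b - d)" q] by auto
    qed
    have "\<exists>!e. e + x * e + x = e"
    proof (rule banach_fix_type[where c = q])
      show "\<forall>y z. dist (y + x * y + x) (z + x * z + x) \<le> q * dist y z"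
        using contr[of "_ - _"] by (simp add: dist_norm algebra_simps)
    qed (use q in auto)
    then obtain e where "e + x * e + x = e" by auto
    then have "x * (- e) = x" by (simp add: algebra_simps neg_eq_iff_add_eq_0)
    then have "x * (- e * b) = x * b" for b by (metis mult.assoc)
    then have "- e * b = b" for b using \<open>inj (\<lambda>b. x * b)\<close> by (metis injD)
    then have "is_identity (- e)" by (rule left_identity_imp_identity)
    then show False using assms by (auto simp: unital_def)
  qed
  then show ?thesis
    by (simp add: norm_unitization_def unitization_opnorm_def unitization_act_def)
qed


section \<open>Real rank\<close>

definition Lg_sa :: "nat \<Rightarrow> (nat \<Rightarrow> 'a::cstar_algebra) set" where
  "Lg_sa n = {a \<in> {..<n} \<rightarrow>\<^sub>E self_adjoints. is_invertible (\<Sum>k<n. a k * a k)}"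

definition Lg_sa_dense :: "'a::cstar_algebra itself \<Rightarrow> nat \<Rightarrow> bool" where
  "Lg_sa_dense _ n \<longleftrightarrow>
     product_topology (\<lambda>_. top_of_set (self_adjoints :: 'a set)) {..<n} closure_of Lg_sa n
       = {..<n} \<rightarrow>\<^sub>E self_adjoints"

definition real_rank_unital :: "'a::cstar_algebra itself \<Rightarrow> enat" where
  "real_rank_unital A =
     (if \<exists>n. Lg_sa_dense A (n + 1) then enat (LEAST n. Lg_sa_dense A (n + 1)) else \<infinity>)"

definition real_rank :: "'a::cstar_algebra itself \<Rightarrow> enat" where
  "real_rank A =
     (if unital A then real_rank_unital A else real_rank_unital TYPE('a unitization))"

end

theory Submission
  imports Defs
begin

text \<open>
  Adjoining a unit to all three algebras does not change their real ranks, even where a unit exists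
  already, so assume that \<open>A\<close>, \<open>E\<close>, \<open>B\<close> are unital and that the range of \<open>A\<close> in \<open>E\<close> consists of the
  elements that \<open>\<pi>\<close> maps to scalars. Two facts carry the proof. If the left ideal generated by
  self-adjoint \<open>x\<^sub>k\<close> contains 1, then \<open>\<Sum>x\<^sub>k\<^sup>2\<close> is invertible; and self-adjoint elements of \<open>B\<close> lift to
  self-adjoint elements of \<open>E\<close> with almost no growth of the norm.

  Quotient: the image of a tuple with invertible sum of squares is again such a tuple.

  Ideal: perturb the given tuple in \<open>A\<close> to a tuple \<open>y\<^sub>k\<close> in \<open>E\<close> whose sum of squares is invertible,
  where \<open>\<pi>(y\<^sub>k)\<close> is close to a scalar \<open>\<lambda>\<^sub>k\<close> and \<open>\<beta> = \<pi>(y\<^sub>0)\<close> is invertible. With a small lift \<open>t\<^sub>k\<close>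
  of \<open>\<beta>\<^sup>-\<^sup>1 (\<pi>(y\<^sub>k) - \<lambda>\<^sub>k) \<beta>\<^sup>-\<^sup>1\<close>, the elements \<open>y\<^sub>k - y\<^sub>0 t\<^sub>k y\<^sub>0\<close> lie in \<open>A\<close> and generate the same left
  ideal of \<open>E\<close> as the \<open>y\<^sub>k\<close>, because \<open>1 - y\<^sub>0 t\<^sub>0\<close> is invertible.

  Extension: perturb the first block \<open>a\<^sub>k\<close> of a tuple so that \<open>\<pi>(s)\<close> is invertible, where
  \<open>s = \<Sum>a\<^sub>k\<^sup>2\<close>, and let \<open>y\<close> be a self-adjoint lift of its inverse. A member \<open>b\<close> of the second block
  differs from \<open>s y b y s\<close> by an element of the kernel; perturb these differences within \<open>A\<close> to
  make their sum of squares invertible. As \<open>s\<close> lies in the left ideal generated by the \<open>a\<^sub>k\<close>, the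
  left ideal generated by both blocks contains 1.
\<close>

section \<open>Unital C*-algebras\<close>

text \<open>\<open>real_normed_algebra_1\<close> brings \<open>0 \<noteq> 1\<close>, so the zero
  algebra is excluded here. Its unitization, like every other, is an instance.\<close>

class cstar_algebra_1 = cstar_algebra + real_normed_algebra_1

lemma star_minus: "star (- x) = - star (x::'a::cstar_algebra)"
  using star_add[of x "- x"] by (simp add: eq_neg_iff_add_eq_0 add.commute)

lemma star_diff: "star (x - y) = star x - star (y::'a::cstar_algebra)"
  using star_add[of x "- y"] by (simp add: star_minus)

lemma star_scaleR: "star (r *\<^sub>R x) = r *\<^sub>R star (x::'a::cstar_algebra)"
  by (simp add: scaleR_scaleC star_scaleC)

lemma scaleC_diff_right: "c *\<^sub>C (x - y) = c *\<^sub>C x - c *\<^sub>C (y::'a::cstar_algebra)"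
  using scaleC_add_right[of c x "- y"] by (simp add: scaleC_minus_right)

lemma star_sum: "star (sum f A) = (\<Sum>a\<in>A. star (f a :: 'a::cstar_algebra))"
  by (induction A rule: infinite_finite_induct) (simp_all add: star_add)

lemma star_one [simp]: "star 1 = (1::'a::cstar_algebra_1)"
proof -
  have "star (star 1 * (1::'a)) = star 1 * 1" by (simp only: star_mult star_star)
  then show ?thesis by (simp add: star_star)
qed

lemma star_of_real [simp]: "star (of_real r) = (of_real r::'a::cstar_algebra_1)"
  by (simp add: of_real_def star_scaleR)

lemma continuous_star: "continuous_on S (star :: 'a::cstar_algebra \<Rightarrow> 'a)"
  by (rule continuous_onI) (auto simp: dist_norm star_diff[symmetric] norm_star intro!: exI)

lemma of_real_commute: "of_real r * x = x * (of_real r::'a::real_algebra_1)"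
  by (simp add: of_real_def)

lemma norm_square_selfadjoint: "star h = h \<Longrightarrow> norm (h * h) = (norm (h::'a::cstar_algebra))\<^sup>2"
  using norm_star_mult_self[of h] by simp

section \<open>Inverses, square roots, and norm bounds from unitaries\<close>

lemma inverse_commute:
  fixes x y z :: "'a::monoid_mult"
  assumes "x * y = 1" "y * x = 1" "z * x = x * z"
  shows "z * y = y * z"
proof -
  have "z * y = (y * x) * z * y" by (simp add: assms)
  also have "\<dots> = y * (x * z) * y" by (simp add: mult.assoc)
  also have "\<dots> = y * z * (x * y)" by (simp only: assms(3)[symmetric] mult.assoc)
  finally show ?thesis by (simp add: assms)
qed

lemma star_inverse:
  fixes x y :: "'a::cstar_algebra_1"
  assumes "x * y = 1" "y * x = 1" "star x = x"
  shows "star y = y"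
proof -
  have "star y * x = 1" using arg_cong[OF assms(1), of star] by (simp add: star_mult assms(3))
  then have "star y * x * y = y" by simp
  then show ?thesis by (simp add: mult.assoc assms(1))
qed

lemma neumann_inverse:
  fixes d :: "'a::{real_normed_algebra_1,banach}"
  assumes "norm d < 1"
  obtains y where "(1 - d) * y = 1" "y * (1 - d) = 1" "norm y \<le> 1 / (1 - norm d)"
proof -
  define y where "y = (\<Sum>n. d ^ n)"
  have s: "summable (\<lambda>n. d ^ n)" using assms by (rule complete_algebra_summable_geometric)
  have head: "(\<Sum>n. d ^ Suc n) = y - 1" using suminf_split_head[OF s] by (simp add: y_def)
  have l: "d * y = y - 1" using suminf_mult[OF s, of d] head by (simp add: y_def)
  have r: "y * d = y - 1" using suminf_mult2[OF s, of d] head by (simp add: y_def power_commutes)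
  have "norm y \<le> 1 + norm d * norm y"
    using norm_triangle_ineq[of 1 "d * y"] norm_mult_ineq[of d y] by (simp add: l)
  then have "norm y \<le> 1 / (1 - norm d)" using assms by (simp add: field_simps)
  with l r show ?thesis by (intro that[of y]) (simp_all add: algebra_simps)
qed

text \<open>Neumann series for \<open>x / r\<close>. The explicit bound later controls the inverse
  of \<open>x + e\<close> for positive \<open>x\<close>, and the size of the lifts in the ideal
  case.\<close>

lemma inverse_near_of_real:
  fixes x :: "'a::{real_normed_algebra_1,banach}"
  assumes "norm (of_real r - x) < \<bar>r\<bar>"
  obtains y where "x * y = 1" "y * x = 1" "norm y \<le> 1 / (\<bar>r\<bar> - norm (of_real r - x))"
proof -
  have r: "r \<noteq> 0" using assms by auto
  define d where "d = (1 / r) *\<^sub>R (of_real r - x)"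
  have nd: "norm d = norm (of_real r - x) / \<bar>r\<bar>" by (simp add: d_def)
  have x: "x = r *\<^sub>R (1 - d)" using r by (simp add: d_def scaleR_diff_right of_real_def)
  have "norm d < 1" using assms nd r by simp
  then obtain y where y: "(1 - d) * y = 1" "y * (1 - d) = 1" "norm y \<le> 1 / (1 - norm d)"
    using neumann_inverse by blast
  have "norm ((1 / r) *\<^sub>R y) \<le> 1 / \<bar>r\<bar> * (1 / (1 - norm d))"
    using mult_left_mono[OF y(3), of "1 / \<bar>r\<bar>"] by simp
  also have "\<dots> = 1 / (\<bar>r\<bar> - norm (of_real r - x))" using r by (simp add: nd field_simps)
  finally show ?thesis using r y by (intro that[of "(1 / r) *\<^sub>R y"]) (simp_all add: x)
qed

text \<open>The square root is \<open>1 - y\<close>, where \<open>y\<close> is the fixed point of \<open>y \<mapsto> (x + y\<^sup>2)/2\<close>.\<close>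

lemma sqrt_one_minus:
  fixes x :: "'a::cstar_algebra_1"
  assumes x: "norm x < 1" "star x = x"
  obtains h where "star h = h" "h * h = 1 - x" "norm (1 - h) < 1"
    "\<And>z. z * x = x * z \<Longrightarrow> z * h = h * z"
proof -
  \<comment> \<open>The smaller root of \<open>norm x + r * r = 2 * r\<close>: the map
    \<open>f\<close> below then sends the ball of radius \<open>r\<close> into itself and contracts
    \<open>S\<close> with factor \<open>r < 1\<close>.\<close>
  define r where "r = 1 - sqrt (1 - norm x)"
  have r: "0 \<le> r" "r < 1" using x(1) by (auto simp: r_def real_le_lsqrt)
  have "(1 - r)\<^sup>2 = 1 - norm x" using x(1) by (simp add: r_def)
  then have r_eq: "norm x + r * r = 2 * r" by (simp add: power2_eq_square algebra_simps)
  \<comment> \<open>Self-adjointness and commuting with whatever commutes with \<open>x\<close> are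
    closed conditions preserved by \<open>f\<close>, so the fixed point inherits both.\<close>
  define S where "S = {y. norm y \<le> r \<and> star y = y \<and> (\<forall>z. z * x = x * z \<longrightarrow> z * y = y * z)}"
  have SD: "norm y \<le> r" "star y = y" "z * x = x * z \<Longrightarrow> z * y = y * z" if "y \<in> S" for y z
    using that by (simp_all add: S_def)
  define f where "f y = (1/2) *\<^sub>R (x + y * y)" for y
  have S_alt: "S = cball 0 r \<inter> {y. star y = y} \<inter> (\<Inter>z\<in>{z. z * x = x * z}. {y. z * y = y * z})"
    by (auto simp: S_def)
  have "closed S" unfolding S_alt
    by (intro closed_Int closed_INT ballI closed_Collect_eq continuous_star continuous_intros closed_cball)
  moreover have "0 \<in> S" using r by (simp add: S_def)
  moreover have "f ` S \<subseteq> S"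
  proof safe
    fix y assume y: "y \<in> S"
    have "norm (x + y * y) \<le> norm x + r * r"
      using SD(1)[OF y] r
      by (intro norm_triangle_le add_mono order_trans[OF norm_mult_ineq] mult_mono) auto
    then have "norm (f y) \<le> r" by (simp add: f_def r_eq)
    moreover have "star (f y) = f y"
      using SD(2)[OF y] x(2) by (simp add: f_def star_scaleR star_add star_mult)
    moreover have "z * f y = f y * z" if z: "z * x = x * z" for z
    proof -
      have "z * y = y * z" using SD(3)[OF y z] .
      then have "z * (y * y) = (y * y) * z" by (metis mult.assoc)
      then show ?thesis using z by (simp add: f_def distrib_left distrib_right)
    qed
    ultimately show "f y \<in> S" unfolding S_def by blast
  qed
  moreover have "dist (f y) (f z) \<le> r * dist y z" if "y \<in> S" "z \<in> S" for y z
  proof -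
    have "f y - f z = (1/2) *\<^sub>R (y * (y - z) + (y - z) * z)"
      by (simp add: f_def scaleR_diff_right[symmetric] right_diff_distrib left_diff_distrib)
    moreover have "norm (y * (y - z) + (y - z) * z) \<le> r * norm (y - z) + norm (y - z) * r"
      using that[THEN SD(1)] r
      by (intro norm_triangle_le add_mono order_trans[OF norm_mult_ineq] mult_mono) auto
    ultimately show ?thesis by (simp add: dist_norm)
  qed
  ultimately have "\<exists>!y\<in>S. f y = y"
    using r by (intro Banach_fix[where c = r]) (auto simp: complete_eq_closed)
  then obtain y where y: "y \<in> S" "f y = y" by blast
  have "2 *\<^sub>R f y = 2 *\<^sub>R y" by (simp add: y(2))
  then have "x + y * y = y + y" by (simp add: f_def scaleR_2)
  then have "x = y + y - y * y" by (simp add: eq_diff_eq)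
  then have "(1 - y) * (1 - y) = 1 - x" by (simp add: left_diff_distrib right_diff_distrib)
  show ?thesis
  proof (rule that[of "1 - y"])
    show "z * (1 - y) = (1 - y) * z" if "z * x = x * z" for z
      using SD(3)[OF y(1) that] by (simp add: left_diff_distrib right_diff_distrib)
  qed (use \<open>(1 - y) * (1 - y) = 1 - x\<close> SD(1,2)[OF y(1)] r in \<open>simp_all add: star_diff\<close>)
qed

text \<open>\<open>z + i h\<close> is a multiple of a unitary, and \<open>z\<close> is its real part.\<close>

lemma norm_le_unitary:
  fixes z h :: "'a::cstar_algebra_1"
  assumes sa: "star z = z" "star h = h" and comm: "z * h = h * z"
    and eq: "z * z + h * h = of_real (c\<^sup>2)" and c: "0 \<le> c"
  shows "norm z \<le> c"
proof -
  define u where "u = z + \<i> *\<^sub>C h"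
  have su: "star u = z - \<i> *\<^sub>C h"
    by (simp add: u_def star_add star_scaleC sa scaleC_minus_left)
  have "star u * u = z * z + h * h"
    unfolding su by (simp add: u_def distrib_left left_diff_distrib right_diff_distrib
        mult_scaleC_left mult_scaleC_right scaleC_add_right scaleC_diff_right scaleC_scaleC comm scaleC_minus_left)
  then have "(norm u)\<^sup>2 = c\<^sup>2"     using norm_star_mult_self[of u] norm_of_real[of "c\<^sup>2", where 'a='a]
    by (simp add: eq del: of_real_power)
  then have nu: "norm u = c" using c by simp
  have "u + star u = 2 *\<^sub>R z" unfolding su by (simp add: u_def scaleR_2)
  then have "2 * norm z = norm (u + star u)" by simp
  also have "\<dots> \<le> norm u + norm (star u)" by (rule norm_triangle_ineq)
  finally show ?thesis by (simp add: norm_star nu)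
qed

section \<open>Positive elements\<close>

text \<open>For a self-adjoint element, the norm condition says that the spectrum lies in
  \<open>[0, 2r]\<close>; it replaces the spectrum throughout.\<close>

definition positive :: "'a::cstar_algebra_1 \<Rightarrow> bool" where
  "positive x \<longleftrightarrow> star x = x \<and> (\<exists>r. norm (of_real r - x) \<le> r)"

lemma positive_selfadjoint: "positive x \<Longrightarrow> star x = x"
  by (simp add: positive_def)

lemma positiveI: "star x = x \<Longrightarrow> norm (of_real r - x) \<le> r \<Longrightarrow> positive x"
  by (auto simp: positive_def)

lemma positive_add:
  assumes "positive x" "positive y" shows "positive (x + y)"
proof -
  obtain r s where "norm (of_real r - x) \<le> r" "norm (of_real s - y) \<le> s"
    using assms by (auto simp: positive_def)
  then have "norm ((of_real r - x) + (of_real s - y)) \<le> r + s" by (intro norm_triangle_le) simp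
  then show ?thesis using assms
    by (intro positiveI[of _ "r + s"]) (auto simp: positive_def star_add algebra_simps)
qed

lemma positive_of_real: "0 \<le> r \<Longrightarrow> positive (of_real r)"
  by (rule positiveI[of _ r]) simp_all

lemma positive_0: "positive 0"
  using positive_of_real[of 0] by simp

lemma positive_sum: "(\<And>a. a \<in> A \<Longrightarrow> positive (f a)) \<Longrightarrow> positive (sum f A)"
  by (induction A rule: infinite_finite_induct) (simp_all add: positive_0 positive_add)

lemma positive_scaleR:
  assumes "positive x" "0 \<le> c" shows "positive (c *\<^sub>R x)"
proof -
  obtain r where r: "norm (of_real r - x) \<le> r" using assms by (auto simp: positive_def)
  have "of_real (c * r) - c *\<^sub>R x = c *\<^sub>R (of_real r - x)"
    by (simp add: of_real_def scaleR_diff_right)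
  then have "norm (of_real (c * r) - c *\<^sub>R x) \<le> c * r"
    using mult_left_mono[OF r assms(2)] assms(2) by simp
  then show ?thesis using assms by (intro positiveI[of _ "c * r"]) (auto simp: positive_def star_scaleR)
qed

lemma positive_of_real_add:
  assumes "star x = x" "norm x \<le> r" shows "positive (of_real r + x)"
  using assms by (intro positiveI[of _ r]) (simp_all add: star_add)

lemma positive_of_real_diff:
  assumes "star x = x" "norm x \<le> r" shows "positive (of_real r - x)"
  using positive_of_real_add[of "- x"] assms by (simp add: star_minus)

text \<open>Scaling \<open>x + e\<close> by \<open>1 / (r + e)\<close> gives \<open>1 - d\<close>.
  The shift by \<open>e\<close> makes \<open>norm d < 1\<close> strict, which the square root of
  \<open>1 - d\<close> and its invertibility require.\<close>

lemma positive_strict_sqrt: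
  fixes x :: "'a::cstar_algebra_1"
  assumes x: "positive x" and e: "0 < e"
  obtains h k where "star h = h" "h * h = x + of_real e" "h * k = 1" "k * h = 1"
    "\<And>z. z * x = x * z \<Longrightarrow> z * h = h * z"
proof -
  obtain r where r: "norm (of_real r - x) \<le> r" using x by (auto simp: positive_def)
  then have r0: "0 \<le> r" using norm_ge_zero order_trans by blast
  define d where "d = (1 / (r + e)) *\<^sub>R (of_real r - x)"
  have "norm (of_real r - x) < r + e" using r e by simp
  then have "norm d < 1" using r0 e by (simp add: d_def del: scaleR_right_diff_distrib)
  moreover have "star d = d" using x by (simp add: d_def star_scaleR star_diff positive_def)
  ultimately obtain h where h: "star h = h" "h * h = 1 - d" "norm (1 - h) < 1"
    and comm: "\<And>z. z * d = d * z \<Longrightarrow> z * h = h * z"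
    using sqrt_one_minus by blast
  obtain k where k: "h * k = 1" "k * h = 1"
    using neumann_inverse[OF h(3)] by auto
  define c where "c = sqrt (r + e)"
  have c: "c > 0" "c * c = r + e" using r0 e by (auto simp: c_def)
  show ?thesis
  proof (rule that[of "c *\<^sub>R h" "(1 / c) *\<^sub>R k"])
    have "(r + e) *\<^sub>R d = of_real r - x" using r0 e by (simp add: d_def)
    then have "(r + e) *\<^sub>R (1 - d) = x + of_real e"
      by (simp add: scaleR_diff_right) (simp add: of_real_def scaleR_add_left)
    then show "(c *\<^sub>R h) * (c *\<^sub>R h) = x + of_real e" by (simp add: h c)
    show "z * (c *\<^sub>R h) = (c *\<^sub>R h) * z" if "z * x = x * z" for z
      using comm[of z] that
      using of_real_commute[of r z]
      by (simp add: d_def right_diff_distrib left_diff_distrib flip: scaleR_diff_right)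
  qed (use c h k in \<open>simp_all add: star_scaleR\<close>)
qed

text \<open>Scale \<open>h\<close> to \<open>g\<close> with \<open>norm g < 1\<close>. The root
  \<open>k\<close> of \<open>1 - g * g\<close> and \<open>g\<close> are the two parts of a unitary,
  so \<open>norm k \<le> 1\<close>, and \<open>1 - g * g = k * k\<close> has norm at most 1. This is
  what makes squares positive.\<close>

lemma norm_of_real_diff_square:
  fixes h :: "'a::cstar_algebra_1"
  assumes h: "star h = h" "(norm h)\<^sup>2 < r"
  shows "norm (of_real r - h * h) \<le> r"
proof -
  have r: "0 < r" using h(2) le_less_trans zero_le_power2 by blast
  define d where "d = (1 / r) *\<^sub>R (h * h)"
  have "norm d < 1" using h r by (simp add: d_def norm_square_selfadjoint field_simps)
  moreover have "star d = d" using h by (simp add: d_def star_scaleR star_mult)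
  ultimately obtain k where k: "star k = k" "k * k = 1 - d"
    and comm: "\<And>z. z * d = d * z \<Longrightarrow> z * k = k * z"
    using sqrt_one_minus by blast
  define g where "g = (1 / sqrt r) *\<^sub>R h"
  have "g * g = d" using r by (simp add: g_def d_def)
  then have "g * k = k * g" by (intro comm) (metis mult.assoc)
  moreover have "star g = g" by (simp add: g_def star_scaleR h)
  ultimately have "norm k \<le> 1"
    using k \<open>g * g = d\<close> by (intro norm_le_unitary[of k g 1]) auto
  then have "norm (1 - d) \<le> 1"
    using norm_square_selfadjoint[OF k(1)] by (simp add: k power_le_one)
  moreover have "of_real r - h * h = r *\<^sub>R (1 - d)"
    using r by (simp add: d_def scaleR_diff_right) (simp add: of_real_def)
  ultimately show ?thesis using r by (simp add: mult_left_le)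
qed

lemma positive_square: "star h = h \<Longrightarrow> positive (h * h)"
  using norm_of_real_diff_square[of h "(norm h)\<^sup>2 + 1"]
  by (intro positiveI[of _ "(norm h)\<^sup>2 + 1"]) (simp_all add: star_mult)

text \<open>The radius in the definition of \<open>positive\<close> is existential; this frees it.
  For small \<open>d\<close> the element \<open>x + d\<close> is a square of norm below
  \<open>r\<close>, and \<open>d\<close> then tends to 0.\<close>

lemma positive_norm_of_real_diff:
  fixes x :: "'a::cstar_algebra_1"
  assumes x: "positive x" "norm x < r"
  shows "norm (of_real r - x) \<le> r"
proof (rule field_le_epsilon)
  fix e :: real assume e: "0 < e"
  define d where "d = min e ((r - norm x) / 2)"
  have d: "0 < d" "d \<le> e" "norm x + d < r" using e x by (auto simp: d_def min_def field_simps)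
  obtain h where h: "star h = h" "h * h = x + of_real d"
    using positive_strict_sqrt[OF x(1) d(1)] by metis
  have "(norm h)\<^sup>2 = norm (x + of_real d)" using norm_square_selfadjoint[OF h(1)] h(2) by simp
  also have "\<dots> \<le> norm x + d" using d norm_triangle_ineq[of x "of_real d"] by simp
  finally have "norm (of_real r - h * h) \<le> r"
    using d by (intro norm_of_real_diff_square h) simp
  moreover have eq: "of_real r - x = (of_real r - h * h) + of_real d" by (simp add: h)
  have "norm (of_real r - x) \<le> norm (of_real r - h * h) + d"
    unfolding eq using norm_triangle_ineq[of "of_real r - h * h" "of_real d"] d by simp
  ultimately have "norm (of_real r - x) \<le> r + d" by linarith
  then show "norm (of_real r - x) \<le> r + e" using d by simp
qed

text \<open>The radii witnessing positivity of \<open>x + e\<close> could grow as \<open>e\<close>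
  tends to 0. By \<open>positive_norm_of_real_diff\<close> the single radius
  \<open>norm x + 1\<close> serves for all small \<open>e\<close>.\<close>

lemma positive_closed:
  fixes x :: "'a::cstar_algebra_1"
  assumes "d > 0" and x: "\<And>e. 0 < e \<Longrightarrow> e < d \<Longrightarrow> positive (x + of_real e)"
  shows "positive x"
proof (rule positiveI)
  have "star (x + of_real (d/2)) = x + of_real (d/2)"
    using assms by (intro positive_selfadjoint x) auto
  then show "star x = x" by (simp add: star_add del: of_real_divide)
  show "norm (of_real (norm x + 1) - x) \<le> norm x + 1"
  proof (rule field_le_epsilon)
    fix e :: real assume e: "0 < e"
    define c where "c = min (e/2) (min (d/2) (1/2))"
    have c: "0 < c" "c < e" "c < d" "c < 1" using e \<open>d > 0\<close> by (auto simp: c_def min_def)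
    have "norm (x + of_real c) < norm x + 1"
      using c norm_triangle_ineq[of x "of_real c"] by simp
    then have "norm (of_real (norm x + 1) - (x + of_real c)) \<le> norm x + 1"
      using c by (intro positive_norm_of_real_diff x)
    moreover have eq: "of_real (norm x + 1) - x = (of_real (norm x + 1) - (x + of_real c)) + of_real c"
      by simp
    have "norm (of_real (norm x + 1) - x) \<le> norm (of_real (norm x + 1) - (x + of_real c)) + c"
      unfolding eq
      using norm_triangle_ineq[of "of_real (norm x + 1) - (x + of_real c)" "of_real c"] c by simp
    ultimately have "norm (of_real (norm x + 1) - x) \<le> (norm x + 1) + c" by linarith
    then show "norm (of_real (norm x + 1) - x) \<le> norm x + 1 + e" using c by simp
  qed
qed

lemma positive_near:
  fixes x y :: "'a::cstar_algebra_1"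
  assumes "positive y" "star x = x" "norm (x - y) \<le> e"
  shows "positive (x + of_real e)"
proof -
  have "positive (of_real e + (x - y))"
    using assms by (intro positive_of_real_add) (auto simp: star_diff positive_def)
  from positive_add[OF assms(1) this] show ?thesis by (simp add: algebra_simps)
qed

lemma positive_add_invertible:
  fixes x :: "'a::cstar_algebra_1"
  assumes x: "positive x" and e: "0 < e"
  obtains y where "(x + of_real e) * y = 1" "y * (x + of_real e) = 1" "norm y \<le> 1 / e" "positive y"
proof -
  obtain r where r: "norm (of_real r - x) \<le> r" using x by (auto simp: positive_def)
  then have r0: "0 \<le> r" using norm_ge_zero order_trans by blast
  have eq: "of_real (r + e) - (x + of_real e) = of_real r - x" by simp
  obtain y where y: "(x + of_real e) * y = 1" "y * (x + of_real e) = 1"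
    "norm y \<le> 1 / (\<bar>r + e\<bar> - norm (of_real r - x))"
    using inverse_near_of_real[of "r + e" "x + of_real e"] r r0 e unfolding eq by auto
  have "norm y \<le> 1 / e"
    using y(3) r r0 e by (elim order_trans) (intro divide_left_mono, auto)
  \<comment> \<open>The inverse \<open>y\<close> is the square of the self-adjoint \<open>k\<close>,
    hence positive.\<close>
  obtain h k where h: "star h = h" "h * h = x + of_real e" "h * k = 1" "k * h = 1"
    using positive_strict_sqrt[OF x e] by metis
  have "star k = k" using star_inverse h by blast
  have "k * k = y * (h * h) * (k * k)" using y(2) h(2) by simp
  also have "\<dots> = y * (h * (h * k) * k)" by (simp only: mult.assoc)
  also have "\<dots> = y" using h by simp
  finally have "positive y" using positive_square[OF \<open>star k = k\<close>] by simp
  with \<open>norm y \<le> 1 / e\<close> show ?thesis using that y by blast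
qed

text \<open>An invertible positive element has a spectral gap at 0. For \<open>0 < e < 1 / M\<close>
  the inverse \<open>k * k\<close> of \<open>x + e\<close> has norm below \<open>M\<close>, so
  \<open>1 - k * k / M\<close> has a root \<open>q\<close>, and \<open>x + e - 1 / M\<close> is the
  square of \<open>q * h\<close>. Then \<open>e\<close> tends to 0.\<close>

lemma positive_invertible_bounded_below:
  fixes x y :: "'a::cstar_algebra_1"
  assumes x: "positive x" and y: "x * y = 1" "y * x = 1"
  obtains e where "0 < e" "positive (x - of_real e)"
proof -
  define M where "M = 2 * norm y + 1"
  have M: "M > 0" using norm_ge_zero[of y] unfolding M_def by linarith
  define d where "d = 1 / M"
  have d: "d > 0" using M by (simp add: d_def)
  have "positive ((x - of_real (1 / M)) + of_real e)" if e: "0 < e" "e < d" for e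
  proof -
    obtain h k where h: "star h = h" "h * h = x + of_real e" "h * k = 1" "k * h = 1"
      using positive_strict_sqrt[OF x e(1)] by metis
    have sk: "star k = k" using star_inverse h by blast
    have hk: "h * h * (k * k) = 1" "k * k * (h * h) = 1"
      by (metis h(3,4) mult.assoc mult_1_right)+
    \<comment> \<open>Resolvent identity \<open>k * k = y - e y (k * k)\<close>. With
      \<open>e * norm y \<le> 1 / 2\<close> it bounds \<open>norm (k * k)\<close> by
      \<open>2 * norm y\<close>, uniformly in \<open>e\<close>.\<close>
    have "k * k = y * x * (k * k)" by (simp add: y)
    also have "\<dots> = y * (h * h * (k * k) - of_real e * (k * k))"
      by (simp add: h(2) algebra_simps)
    also have "\<dots> = y - e *\<^sub>R (y * (k * k))"
      by (simp add: hk(1) right_diff_distrib of_real_def)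
    finally have "norm (k * k) \<le> norm y + e * (norm y * norm (k * k))"
      using norm_triangle_ineq4[of y "e *\<^sub>R (y * (k * k))"] e
      by (simp, elim order_trans) (simp add: mult_left_mono norm_mult_ineq)
    moreover have "e * norm y \<le> 1 / 2"
    proof -
      have "e * M < 1" using e M by (simp add: d_def field_simps)
      then show ?thesis using e by (simp add: M_def algebra_simps)
    qed
    then have "(e * norm y) * norm (k * k) \<le> 1 / 2 * norm (k * k)"
      by (intro mult_right_mono) auto
    ultimately have "norm (k * k) \<le> 2 * norm y" by (simp add: mult.assoc)
    then have nk: "norm ((1 / M) *\<^sub>R (k * k)) < 1" using M by (simp add: M_def field_simps)
    have skk: "star ((1 / M) *\<^sub>R (k * k)) = (1 / M) *\<^sub>R (k * k)" by (simp add: star_scaleR star_mult sk)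
    obtain q where q: "star q = q" "q * q = 1 - (1 / M) *\<^sub>R (k * k)"
      and comm: "\<And>z. z * ((1 / M) *\<^sub>R (k * k)) = ((1 / M) *\<^sub>R (k * k)) * z \<Longrightarrow> z * q = q * z"
      using sqrt_one_minus[OF nk skk] by blast
    have "h * (k * k) = (k * k) * h" by (metis h(3,4) mult.assoc mult_1_left mult_1_right)
    then have hq: "h * q = q * h" by (intro comm) simp
    have "(q * h) * (q * h) = (q * q) * (h * h)" by (metis hq mult.assoc)
    also have "\<dots> = x + of_real e - (1 / M) *\<^sub>R 1"
      by (simp add: q left_diff_distrib hk h(2)[symmetric] del: scaleR_left_diff_distrib)
    finally have "(q * h) * (q * h) = (x - of_real (1 / M)) + of_real e"
      by (simp add: of_real_def)
    moreover have "star (q * h) = q * h" by (simp add: star_mult q h hq)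
    ultimately show ?thesis using positive_square[of "q * h"] by simp
  qed
  then have "positive (x - of_real (1 / M))" using d positive_closed by blast
  then show ?thesis using M that[of "1 / M"] by simp
qed

text \<open>Centre at \<open>r / 2\<close>: for \<open>z = p - r / 2\<close> and
  \<open>c = r / 2 + e\<close>, the roots \<open>h\<close> and \<open>k\<close> of
  \<open>c + z\<close> and \<open>c - z\<close> commute, and
  \<open>z * z + (h * k) * (h * k) = c^2\<close>. Thus \<open>z\<close> is the real part of
  \<open>c\<close> times a unitary and \<open>norm z \<le> c\<close>.\<close>

lemma positive_le_norm:
  fixes p :: "'a::cstar_algebra_1"
  assumes p: "positive p" "positive (of_real r - p)"
  shows "norm p \<le> r"
proof (rule field_le_epsilon)
  fix e :: real assume e: "0 < e"
  obtain h where h: "star h = h" "h * h = p + of_real e"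
    and hc: "\<And>z. z * p = p * z \<Longrightarrow> z * h = h * z"
    using positive_strict_sqrt[OF p(1) e] by metis
  obtain k where k: "star k = k" "k * k = of_real r - p + of_real e"
    and kc: "\<And>z. z * (of_real r - p) = (of_real r - p) * z \<Longrightarrow> z * k = k * z"
    using positive_strict_sqrt[OF p(2) e] by metis
  define c where "c = r / 2 + e"
  define z where "z = p - of_real (r / 2)"
  have hp: "h * p = p * h" using hc[of p] by simp
  have "p * k = k * p"     using of_real_commute[of r p] by (intro kc) (simp add: left_diff_distrib right_diff_distrib)
  then have "k * h = h * k" by (intro hc) simp
  have kp: "k * p = p * k" using \<open>p * k = k * p\<close> by simp
  have pk: "p * (h * k) = (h * k) * p" by (metis hp kp mult.assoc)
  have "(h * k) * (h * k) = (h * h) * (k * k)" by (metis \<open>k * h = h * k\<close> mult.assoc)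
  also have "h * h = of_real c + z" by (simp add: h c_def z_def)
  also have "k * k = of_real c - z"
    by (simp add: k c_def z_def algebra_simps) (simp add: flip: of_real_add of_real_diff)
  also have "(of_real c + z) * (of_real c - z) = of_real (c\<^sup>2) - z * z"
    using of_real_commute[of c z] by (simp add: distrib_right right_diff_distrib power2_eq_square)
  finally have "z * z + (h * k) * (h * k) = of_real (c\<^sup>2)" by simp
  moreover have "z * (h * k) = (h * k) * z"
    using of_real_commute[of "r / 2" "h * k"]
    by (simp add: z_def left_diff_distrib right_diff_distrib pk del: of_real_divide)
  moreover have "star z = z" using p by (simp add: z_def star_diff positive_def)
  moreover have "star (h * k) = h * k" by (simp add: star_mult h k \<open>k * h = h * k\<close>)
  moreover have "0 \<le> r"
  proof -
    have "positive (of_real r :: 'a)" using positive_add[OF p] by simp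
    then obtain s where s: "norm (of_real s - of_real r :: 'a) \<le> s" by (auto simp: positive_def)
    then have "\<bar>s - r\<bar> \<le> s" by (metis norm_of_real of_real_diff real_norm_def)
    then show ?thesis by simp
  qed
  ultimately have "norm z \<le> c" using e by (intro norm_le_unitary[of z "h * k" c]) (auto simp: c_def)
  moreover have "p = z + of_real (r / 2)" by (simp add: z_def)
  ultimately show "norm p \<le> r + e"
    using norm_triangle_ineq[of z "of_real (r / 2)"] \<open>0 \<le> r\<close>
    by (simp add: c_def)
qed

section \<open>Conjugation of positive elements\<close>

lemma positive_perturbation:
  fixes x :: "'a::cstar_algebra_1"
  assumes "positive (y - of_real e)" "star x = x" "norm (x - y) \<le> e"
  shows "positive x"
  using positive_near[of "y - of_real e" "x - of_real e" e] assms
  by (simp add: star_diff)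

text \<open>The path \<open>w\<^sub>t p w\<^sub>t\<close> with \<open>w\<^sub>t = 1 + t (v - 1)\<close> stays invertible, so it cannot leave the
  positive cone.\<close>

lemma positive_conjugate_strict:
  fixes v p :: "'a::cstar_algebra_1"
  assumes v: "positive (v - of_real d)" "0 < d" and p: "positive (p - of_real e)" "0 < e"
  shows "positive (v * p * v)"
proof -
  define w where "w t = of_real (1 - t) + t *\<^sub>R v" for t
  define x where "x t = w t * p * w t" for t
  have sv: "star v = v" using positive_selfadjoint[OF v(1)] by (simp add: star_diff)
  have sp: "star p = p" using positive_selfadjoint[OF p(1)] by (simp add: star_diff)
  have sw: "star (w t) = w t" for t by (simp add: w_def star_add star_scaleR sv del: of_real_diff)
  have sx: "star (x t) = x t" for t by (simp add: x_def star_mult sw sp mult.assoc)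
  have inv: "\<exists>y. x t * y = 1 \<and> y * x t = 1" if t: "t \<in> {0..1}" for t
  proof -
    \<comment> \<open>Lower bound of \<open>w t\<close>, as a convex combination of the lower bounds
      1 and \<open>d\<close> of its two ends.\<close>
    define c where "c = (1 - t) + t * d"
    have c: "0 < c" using t v(2) by (cases "t = 1") (auto simp: c_def intro: add_pos_nonneg)
    have "w t = t *\<^sub>R (v - of_real d) + of_real c"
      by (simp add: w_def c_def algebra_simps of_real_def)
    moreover have "positive (t *\<^sub>R (v - of_real d))" using t v by (intro positive_scaleR) auto
    ultimately obtain y where y: "w t * y = 1" "y * w t = 1"
      using positive_add_invertible[OF _ c] by metis
    obtain q where q: "p * q = 1" "q * p = 1"
      using positive_add_invertible[OF p] by auto
    have "x t * (y * q * y) = w t * (p * ((w t * y) * q)) * y" by (simp add: x_def mult.assoc)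
    moreover have "(y * q * y) * x t = y * (q * ((y * w t) * p)) * w t" by (simp add: x_def mult.assoc)
    ultimately have "x t * (y * q * y) = 1 \<and> (y * q * y) * x t = 1" by (simp add: y q)
    then show ?thesis by blast
  qed
  have cont: "continuous_on {0..1} x" unfolding x_def w_def by (intro continuous_intros)
  \<comment> \<open>\<open>S\<close> is open because an invertible positive element is bounded below
    and so stays positive under small self-adjoint perturbations; it is closed by
    \<open>positive_closed\<close>. Connectedness of the interval carries positivity from 0 to
    1.\<close>
  define S where "S = {t \<in> {0..1}. positive (x t)}"
  have "openin (top_of_set {0..1}) S"
    unfolding openin_contains_ball
  proof (intro conjI ballI)
    fix t assume "t \<in> S"
    then have t: "t \<in> {0..1}" "positive (x t)" by (auto simp: S_def)
    obtain y where "x t * y = 1" "y * x t = 1" using inv t by blast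
    then obtain e where e: "0 < e" "positive (x t - of_real e)"
      using positive_invertible_bounded_below t(2) by metis
    obtain r where r: "0 < r" "\<And>s. s \<in> {0..1} \<Longrightarrow> dist s t < r \<Longrightarrow> dist (x s) (x t) < e"
      using cont[unfolded continuous_on_iff] t(1) e(1) by metis
    have "positive (x s)" if "s \<in> {0..1}" "dist s t < r" for s
      using r(2)[OF that] by (intro positive_perturbation[OF e(2) sx]) (simp add: dist_norm)
    then show "\<exists>r>0. ball t r \<inter> {0..1} \<subseteq> S"
      using r(1) by (intro exI[of _ r]) (auto simp: S_def dist_commute)
  qed (auto simp: S_def)
  moreover have "closedin (top_of_set {0..1}) S"
    unfolding closedin_limpt
  proof (intro conjI allI impI)
    fix t assume t: "t islimpt S \<and> t \<in> {0..1}"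
    have "positive (x t + of_real e)" if e: "0 < e" for e
    proof -
      obtain r where r: "0 < r" "\<And>s. s \<in> {0..1} \<Longrightarrow> dist s t < r \<Longrightarrow> dist (x s) (x t) < e"
        using cont[unfolded continuous_on_iff] t e by metis
      obtain s where "s \<in> S" "dist s t < r" using t r(1) unfolding islimpt_approachable by metis
      then show ?thesis
        using r(2)[of s] by (intro positive_near[of "x s"] sx) (auto simp: S_def dist_norm norm_minus_commute)
    qed
    then have "positive (x t)" by (rule positive_closed[OF zero_less_one])
    then show "t \<in> S" using t by (simp add: S_def)
  qed (auto simp: S_def)
  moreover have "0 \<in> S"
    using positive_add[OF p(1) positive_of_real[of e]] p(2) by (simp add: S_def x_def w_def)
  ultimately have "S = {0..1}"
    using connected_Icc[of "0::real" 1] unfolding connected_clopen by blast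
  then have "1 \<in> S" by simp
  then show ?thesis by (simp add: S_def x_def w_def)
qed

lemma positive_conjugate:
  fixes v p :: "'a::cstar_algebra_1"
  assumes v: "positive (v - of_real d)" "0 < d" and p: "positive p"
  shows "positive (v * p * v)"
proof (rule positive_closed[OF zero_less_one])
  fix e :: real assume e: "0 < e"
  \<comment> \<open>Replacing \<open>p\<close> by \<open>p + c\<close> makes the strict version
    applicable and changes the conjugate by \<open>c * (v * v)\<close>, of norm at most
    \<open>e\<close>.\<close>
  define c where "c = e / ((norm v)\<^sup>2 + 1)"
  have sv: "star v = v" using positive_selfadjoint[OF v(1)] by (simp add: star_diff)
  have c: "0 < c" "c * (norm v)\<^sup>2 \<le> e" using e by (auto simp: c_def field_simps add_pos_nonneg)
  have "positive (v * (p + of_real c) * v)" using p c by (intro positive_conjugate_strict[OF v, of _ c]) auto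
  moreover have "norm (v * p * v - v * (p + of_real c) * v) \<le> e"
  proof -
    have "v * p * v - v * (p + of_real c) * v = - (c *\<^sub>R (v * v))"
      by (simp add: algebra_simps of_real_def)
    then show ?thesis using c norm_square_selfadjoint[OF sv] by simp
  qed
  ultimately show "positive (v * p * v + of_real e)"
    using sv positive_selfadjoint[OF p] by (intro positive_near) (auto simp: star_mult mult.assoc)
qed

section \<open>Left ideals generated by self-adjoint elements\<close>

text \<open>Over a unital ring and for finite \<open>A\<close>, this is the left ideal generated by
  the \<open>x k\<close>.\<close>

definition left_combinations :: "('i \<Rightarrow> 'a::semiring_0) \<Rightarrow> 'i set \<Rightarrow> 'a set" where
  "left_combinations x A = {\<Sum>k\<in>A. z k * x k | z. True}"

lemma left_combinations_add:
  "y \<in> left_combinations x A \<Longrightarrow> z \<in> left_combinations x A \<Longrightarrow> y + z \<in> left_combinations x A"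
  unfolding left_combinations_def
  by (auto simp: distrib_right[symmetric] sum.distrib[symmetric])

lemma left_combinations_mult:
  "y \<in> left_combinations x A \<Longrightarrow> z * y \<in> left_combinations x A"
  unfolding left_combinations_def by (auto simp: sum_distrib_left mult.assoc[symmetric])

lemma left_combinations_minus:
  fixes x :: "'i \<Rightarrow> 'a::ring_1"
  shows "y \<in> left_combinations x A \<Longrightarrow> - y \<in> left_combinations x A"
  using left_combinations_mult[of y x A "- 1"] by simp

lemma left_combinations_diff:
  fixes x :: "'i \<Rightarrow> 'a::ring_1"
  shows "y \<in> left_combinations x A \<Longrightarrow> z \<in> left_combinations x A \<Longrightarrow> y - z \<in> left_combinations x A"
  using left_combinations_add[of y x A "- z"] left_combinations_minus[of z x A] by simp

lemma left_combinations_generator: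
  fixes x :: "'i \<Rightarrow> 'a::semiring_1"
  assumes "finite A" "k \<in> A"
  shows "x k \<in> left_combinations x A"
proof -
  have "(\<Sum>i\<in>A. (if i = k then 1 else 0) * x i) = (\<Sum>i\<in>A. if i = k then x i else 0)"
    by (intro sum.cong) auto
  then have "(\<Sum>i\<in>A. (if i = k then 1 else 0) * x i) = x k"
    using assms by simp
  then show ?thesis
    unfolding left_combinations_def mem_Collect_eq
    by (intro exI[of _ "\<lambda>i. if i = k then 1 else 0"]) simp
qed

lemma left_combinations_sum:
  fixes x :: "'i \<Rightarrow> 'a::semiring_0"
  assumes "\<And>j. j \<in> B \<Longrightarrow> f j \<in> left_combinations x A"
  shows "sum f B \<in> left_combinations x A"
proof -
  have "0 \<in> left_combinations x A"
    unfolding left_combinations_def by (auto intro!: exI[of _ "\<lambda>_. 0"])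
  then show ?thesis using assms
    by (induction B rule: infinite_finite_induct) (auto intro: left_combinations_add)
qed

text \<open>Let \<open>v\<close> be the inverse of \<open>w + e\<close>. From
  \<open>1 = \<Sum>z k * x k\<close> comes \<open>v = \<Sum>z k * (x k * v)\<close>, and
  \<open>v * (x k * x k) * v \<le> v * w * v\<close> in the positive order bounds each
  \<open>x k * v\<close> by \<open>sqrt (2 * norm v)\<close>. Hence
  \<open>norm v \<le> 2 * C^2\<close>, a bound free of \<open>e\<close>. For
  \<open>e = 1 / (4 * C^2)\<close> this makes \<open>1 - e v\<close>, which equals both
  \<open>w * v\<close> and \<open>v * w\<close>, invertible.\<close>

lemma sum_squares_invertible:
  fixes x :: "'i \<Rightarrow> 'a::cstar_algebra_1"
  assumes fin: "finite A" and sa: "\<And>k. k \<in> A \<Longrightarrow> star (x k) = x k"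
    and one: "1 \<in> left_combinations x A"
  obtains y where "(\<Sum>k\<in>A. x k * x k) * y = 1" "y * (\<Sum>k\<in>A. x k * x k) = 1"
proof -
  define w where "w = (\<Sum>k\<in>A. x k * x k)"
  obtain z where z: "1 = (\<Sum>k\<in>A. z k * x k)" using one by (auto simp: left_combinations_def)
  define C where "C = (\<Sum>k\<in>A. norm (z k)) + 1"
  have C: "C > 0" by (simp add: C_def sum_nonneg add_nonneg_pos)
  define e where "e = 1 / (4 * C\<^sup>2)"
  have e: "0 < e" using C by (simp add: e_def)
  have w: "positive w" unfolding w_def by (intro positive_sum positive_square sa)
  obtain v where v: "(w + of_real e) * v = 1" "v * (w + of_real e) = 1" "norm v \<le> 1 / e" "positive v"
    using positive_add_invertible[OF w e] by metis
  have sv: "star v = v" using v(4) by (rule positive_selfadjoint)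
  obtain d where d: "0 < d" "positive (v - of_real d)"
    using positive_invertible_bounded_below[OF v(4), of "w + of_real e"] v by metis
  have wv: "w * v = 1 - e *\<^sub>R v" using v(1) by (simp add: algebra_simps of_real_def)
  have "norm (w * v) \<le> 1 + e * norm v"
    unfolding wv using norm_triangle_ineq4[of 1 "e *\<^sub>R v"] e by simp
  also have "1 + e * norm v \<le> 2" using v(3) e by (simp add: field_simps)
  finally have "norm v * norm (w * v) \<le> norm v * 2" by (intro mult_left_mono) auto
  then have vwv: "norm (v * w * v) \<le> 2 * norm v"
    using norm_mult_ineq[of v "w * v"] by (simp add: mult.assoc)
  have xv: "norm (x k * v) \<le> sqrt (2 * norm v)" if k: "k \<in> A" for k
  proof (rule real_le_rsqrt)
    have sq: "v * (x k * x k) * v = star (x k * v) * (x k * v)"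
      by (simp add: star_mult sv sa[OF k] mult.assoc)
    have "w - x k * x k = (\<Sum>i\<in>A - {k}. x i * x i)"
      using fin k by (simp add: w_def sum.remove)
    then have "positive (w - x k * x k)" by (auto intro!: positive_sum positive_square sa)
    then have 1: "positive (v * (w - x k * x k) * v)" by (rule positive_conjugate[OF d(2,1)])
    have 2: "positive (v * (x k * x k) * v)"
      by (intro positive_conjugate[OF d(2,1)] positive_square sa k)
    have 3: "positive (v * w * v)" by (rule positive_conjugate[OF d(2,1) w])
    have 4: "positive (of_real (norm (v * w * v)) - v * w * v)"
      using positive_selfadjoint[OF 3] by (intro positive_of_real_diff) auto
    have "of_real (norm (v * w * v)) - v * (x k * x k) * v =
        (of_real (norm (v * w * v)) - v * w * v) + v * (w - x k * x k) * v"
      by (simp add: algebra_simps)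
    then have "positive (of_real (norm (v * w * v)) - v * (x k * x k) * v)"
      using positive_add[OF 4 1] by (simp only:)
    then have "norm (v * (x k * x k) * v) \<le> norm (v * w * v)" by (rule positive_le_norm[OF 2])
    then show "(norm (x k * v))\<^sup>2 \<le> 2 * norm v" using vwv by (simp add: sq norm_star_mult_self)
  qed
  have "v = (\<Sum>k\<in>A. z k * (x k * v))"
    using z by (metis (no_types, lifting) mult.assoc mult_1_left sum.cong sum_distrib_right)
  then have "norm v \<le> (\<Sum>k\<in>A. norm (z k * (x k * v)))" using norm_sum by metis
  also have "\<dots> \<le> (\<Sum>k\<in>A. norm (z k) * sqrt (2 * norm v))"
    by (intro sum_mono order_trans[OF norm_mult_ineq] mult_left_mono xv) auto
  also have "\<dots> \<le> C * sqrt (2 * norm v)"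
    unfolding C_def sum_distrib_right[symmetric] by (intro mult_right_mono) auto
  finally have "(norm v)\<^sup>2 \<le> (C * sqrt (2 * norm v))\<^sup>2" by (intro power_mono) auto
  then have "norm v * norm v \<le> (2 * C\<^sup>2) * norm v" by (simp add: power2_eq_square power_mult_distrib algebra_simps)
  moreover have "norm v > 0" using v(1) by auto
  ultimately have "norm v \<le> 2 * C\<^sup>2" by simp
  moreover have "0 < C\<^sup>2" using C by simp
  ultimately have "norm v < 4 * C\<^sup>2" by linarith
  then have ev: "norm (e *\<^sub>R v) < 1" using C e by (simp add: e_def field_simps)
  obtain y where y: "(1 - e *\<^sub>R v) * y = 1" "y * (1 - e *\<^sub>R v) = 1"
    using neumann_inverse[OF ev] by auto
  have vw: "v * w = 1 - e *\<^sub>R v" using v(2) by (simp add: algebra_simps of_real_def)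
  have "w * (v * y) = 1" using y(1) by (simp add: wv mult.assoc[symmetric])
  moreover have "(y * v) * w = 1" using y(2) by (simp add: vw mult.assoc)
  \<comment> \<open>A right inverse and a left inverse of \<open>w\<close> coincide.\<close>
  moreover have "v * y = y * v" by (metis calculation mult.assoc mult_1_left mult_1_right)
  ultimately show ?thesis using that unfolding w_def by metis
qed

section \<open>Unital homomorphisms\<close>

text \<open>\<open>h\<close> is the root of \<open>1 - x * x\<close>, so \<open>x + i h\<close> is
  unitary. This encodes a norm bound in equations, which homomorphisms preserve.\<close>

lemma selfadjoint_unitary_partner:
  fixes x :: "'a::cstar_algebra_1"
  assumes x: "star x = x" "norm x < 1"
  obtains h where "star h = h" "x * x + h * h = 1" "x * h = h * x" "norm (1 - h) < 1"
proof -
  have "norm (x * x) < 1" using x by (simp add: norm_square_selfadjoint power_less_one_iff)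
  moreover have "star (x * x) = x * x" using x by (simp add: star_mult)
  ultimately obtain h where h: "star h = h" "h * h = 1 - x * x" "norm (1 - h) < 1"
    and comm: "\<And>z. z * (x * x) = (x * x) * z \<Longrightarrow> z * h = h * z"
    using sqrt_one_minus by blast
  have "x * h = h * x" by (intro comm) (simp add: mult.assoc)
  then show ?thesis using h by (intro that[of h]) auto
qed

lemma norm_le_one_unitary:
  fixes z h :: "'a::cstar_algebra_1"
  assumes "star z = z" "star h = h" "z * h = h * z" "z * z + h * h = 1"
  shows "norm z \<le> 1"
  using norm_le_unitary[of z h 1] assms by simp

locale unital_star_hom =
  fixes f :: "'a::cstar_algebra_1 \<Rightarrow> 'b::cstar_algebra_1"
  assumes star_hom: "star_hom f" and map_one [simp]: "f 1 = 1"
begin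

lemma map_add [simp]: "f (x + y) = f x + f y"
  using star_hom by (simp add: star_hom_def)

lemma map_mult [simp]: "f (x * y) = f x * f y"
  using star_hom by (simp add: star_hom_def)

lemma map_star [simp]: "f (star x) = star (f x)"
  using star_hom by (simp add: star_hom_def)

lemma map_scaleC [simp]: "f (c *\<^sub>C x) = c *\<^sub>C f x"
  using star_hom by (simp add: star_hom_def)

lemma map_scaleR [simp]: "f (r *\<^sub>R x) = r *\<^sub>R f x"
  by (simp add: scaleR_scaleC)

lemma map_zero [simp]: "f 0 = 0"
  using map_add[of 0 0] by (simp del: map_add)

lemma map_diff [simp]: "f (x - y) = f x - f y"
  using map_add[of "x - y" y] by (simp del: map_add)

lemma map_of_real [simp]: "f (of_real r) = of_real r"
  by (simp add: of_real_def)

lemma map_sum: "f (sum g A) = (\<Sum>a\<in>A. f (g a))"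
  by (induction A rule: infinite_finite_induct) simp_all

text \<open>Automatic contractivity: the equations tying a scaled \<open>x\<close> to its unitary
  partner survive \<open>f\<close>, and they bound the norm of the image.\<close>

lemma norm_map_selfadjoint_le:
  assumes x: "star x = x"
  shows "norm (f x) \<le> norm x"
proof (rule dense_ge)
  fix c assume c: "norm x < c"
  then have c0: "0 < c" using norm_ge_zero le_less_trans by blast
  define g where "g = (1 / c) *\<^sub>R x"
  have g: "star g = g" "norm g < 1" using x c c0 by (simp_all add: g_def star_scaleR)
  obtain h where h: "star h = h" "g * g + h * h = 1" "g * h = h * g"
    using selfadjoint_unitary_partner[OF g] by metis
  have "f g * f g + f h * f h = 1" using arg_cong[OF h(2), of f] by simp
  moreover have "f g * f h = f h * f g" using arg_cong[OF h(3), of f] by simp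
  ultimately have "norm (f g) \<le> 1"
    using g(1) h(1) by (intro norm_le_one_unitary[of _ "f h"]) (simp_all flip: map_star)
  then show "norm (f x) \<le> c" using c0 by (simp add: g_def field_simps)
qed

lemma norm_map_le: "norm (f x) \<le> norm x"
proof -
  have "norm (f (star x * x)) \<le> norm (star x * x)"
    by (intro norm_map_selfadjoint_le) (simp add: star_mult star_star)
  then have "(norm (f x))\<^sup>2 \<le> (norm x)\<^sup>2" by (simp add: norm_star_mult_self)
  then show ?thesis by (rule power2_le_imp_le) simp
qed

section \<open>Lifting self-adjoint elements with norm control\<close>

lemma lift_selfadjoint:
  assumes "f x = d" "star d = d"
  obtains y where "f y = d" "star y = y"
proof -
  have "(1 / 2) *\<^sub>R (d + d) = d" by (simp flip: scaleR_2)
  then show ?thesis using assms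
    by (intro that[of "(1/2) *\<^sub>R (x + star x)"])
      (simp_all add: star_scaleR star_add star_star add.commute del: scaleR_right_distrib)
qed

text \<open>Since \<open>d = 2t/(1 + t\<^sup>2)\<close> for \<open>t = d/(1 + \<surd>(1 - d\<^sup>2))\<close>, it is enough to lift \<open>t\<close> to a
  self-adjoint \<open>\<tau>\<close>: the element \<open>2\<tau>/(1 + \<tau>\<^sup>2)\<close> has norm at most 1, its unitary partner being
  \<open>(1 - \<tau>\<^sup>2)/(1 + \<tau>\<^sup>2)\<close>.\<close>

lemma lift_selfadjoint_norm_le_one:
  assumes surj: "surj f" and d: "star d = d" "norm d < 1"
  obtains y where "f y = d" "star y = y" "norm y \<le> 1"
proof -
  obtain s where s: "star s = s" "d * d + s * s = 1" "d * s = s * d" "norm (1 - s) < 1"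
    using selfadjoint_unitary_partner[OF d] by metis
  \<comment> \<open>\<open>1 + s\<close> is invertible, being within distance 1 of the scalar
    2.\<close>
  have two: "of_real 2 = 1 + (1::'b)" by simp
  have "of_real 2 - (1 + s) = 1 - s" unfolding two by (rule add_diff_cancel_left)
  then have "norm (of_real 2 - (1 + s)) < \<bar>2\<bar>" using s(4) by (simp only:)
  then obtain u where u: "(1 + s) * u = 1" "u * (1 + s) = 1"
    using inverse_near_of_real by metis
  have su: "star u = u" using u by (rule star_inverse) (simp add: star_add s)
  have du: "d * u = u * d" using u by (rule inverse_commute) (simp add: distrib_left distrib_right s)
  define t where "t = d * u"
  have "star t = t" by (simp add: t_def star_mult su d du)
  then obtain \<tau> where \<tau>: "f \<tau> = t" "star \<tau> = \<tau>"
    using surj lift_selfadjoint[of "inv f t" t] by (auto simp: surj_f_inv_f)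
  define T where "T = \<tau> * \<tau>"
  have "positive T" unfolding T_def by (rule positive_square[OF \<tau>(2)])
  then obtain k where k: "(T + 1) * k = 1" "k * (T + 1) = 1"
    using positive_add_invertible[of T 1] by auto
  have "star T = T" by (simp add: T_def star_mult \<tau>)
  have sk: "star k = k" using k by (rule star_inverse) (simp add: star_add \<open>star T = T\<close>)
  have \<tau>k: "\<tau> * k = k * \<tau>"
    using k by (rule inverse_commute) (simp add: T_def distrib_left distrib_right mult.assoc)
  then have Tk: "T * k = k * T" unfolding T_def by (metis mult.assoc)
  have "\<tau> * T = T * \<tau>" by (simp add: T_def mult.assoc)
  \<comment> \<open>Rational parametrization of the circle: \<open>y * y + z * z = 1\<close> reduces
    to \<open>4 T + (1 - T)^2 = (1 + T)^2\<close>.\<close>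
  define y where "y = 2 *\<^sub>R (\<tau> * k)"
  define z where "z = (1 - T) * k"
  have "y * y = 4 *\<^sub>R (\<tau> * (k * \<tau>) * k)" by (simp add: y_def mult.assoc)
  also have "\<tau> * (k * \<tau>) * k = T * (k * k)" by (simp add: T_def mult.assoc flip: \<tau>k)
  finally have yy: "y * y = 4 *\<^sub>R T * (k * k)" by simp
  have Tk': "k * (1 - T) = (1 - T) * k" by (simp add: left_diff_distrib right_diff_distrib Tk)
  have "z * z = (1 - T) * (k * (1 - T)) * k" by (simp add: z_def mult.assoc)
  also have "\<dots> = ((1 - T) * (1 - T)) * (k * k)" unfolding Tk' by (simp add: mult.assoc)
  finally have zz: "z * z = ((1 - T) * (1 - T)) * (k * k)" .
  have "4 *\<^sub>R T = T + T + T + T"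
    using scaleR_left_distrib[of 2 2 T] by (simp add: scaleR_2 add.assoc)
  then have "4 *\<^sub>R T + (1 - T) * (1 - T) = (T + 1) * (T + 1)"
    by (simp add: left_diff_distrib right_diff_distrib distrib_left distrib_right)
  then have "y * y + z * z = (T + 1) * (T + 1) * (k * k)"
    by (simp only: yy zz distrib_right[symmetric])
  also have "\<dots> = (T + 1) * ((T + 1) * k) * k" by (simp only: mult.assoc)
  finally have yz: "y * y + z * z = 1" by (simp add: k)
  have sy: "star y = y" by (simp add: y_def star_scaleR star_mult sk \<tau> \<tau>k)
  have sz: "star z = z" by (simp add: z_def star_mult star_diff sk \<open>star T = T\<close> Tk')
  have "\<tau> * z = z * \<tau>"
    by (simp add: z_def left_diff_distrib right_diff_distrib mult.assoc \<tau>k[symmetric])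
      (simp add: \<open>\<tau> * T = T * \<tau>\<close> flip: mult.assoc)
  moreover have "k * z = z * k"
    by (simp add: z_def Tk' flip: mult.assoc)
  ultimately have "y * z = z * y"
    by (simp add: y_def) (metis mult.assoc)
  then have "norm y \<le> 1" using norm_le_one_unitary[OF sy sz _ yz] by simp
  \<comment> \<open>Now \<open>f y = d\<close>: since \<open>d^2 + (1 + s)^2 = 2 (1 + s)\<close>,
    multiplying by \<open>u * u\<close> gives \<open>t * t + 1 = 2 u\<close>. So
    \<open>2 f k\<close> is the inverse \<open>1 + s\<close> of \<open>u\<close>, and
    \<open>t (1 + s) = d\<close>.\<close>
  have "(t * t + 1) * f k = 1" "f k * (t * t + 1) = 1"
    using arg_cong[OF k(1), of f] arg_cong[OF k(2), of f] by (simp_all add: T_def \<tau>)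
  have "(1 + s) * (1 + s) = 1 + s + s + s * s" by (simp add: distrib_left distrib_right add.assoc)
  then have "d * d + (1 + s) * (1 + s) = (d * d + s * s) + (1 + s + s)" by (simp add: ac_simps)
  then have "d * d + (1 + s) * (1 + s) = 2 *\<^sub>R (1 + s)"
    by (simp only: s(2) scaleR_2) (simp only: ac_simps)
  moreover have "(d * d + (1 + s) * (1 + s)) * (u * u) = t * t + 1"
  proof -
    have "d * d * (u * u) = t * t" unfolding t_def by (metis du mult.assoc)
    moreover have "(1 + s) * (1 + s) * (u * u) = 1" by (metis u(1) mult.assoc mult_1_right)
    ultimately show ?thesis by (simp only: distrib_right)
  qed
  moreover have "(2 *\<^sub>R (1 + s)) * (u * u) = 2 *\<^sub>R u" by (metis u(1) mult.assoc mult_1_left mult_scaleR_left)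
  ultimately have tt: "t * t + 1 = 2 *\<^sub>R u" by simp
  have "f k * (2 *\<^sub>R u) * (1 + s) = 1 + s" using \<open>f k * (t * t + 1) = 1\<close> by (simp only: tt mult_1_left)
  then have "2 *\<^sub>R f k = 1 + s" using u(2) by (simp add: mult.assoc del: scaleR_right_distrib)
  moreover have "f y = t * (2 *\<^sub>R f k)" by (simp add: y_def \<tau>)
  ultimately have "f y = d" using u(2) by (simp add: t_def mult.assoc)
  then show ?thesis using that sy \<open>norm y \<le> 1\<close> by blast
qed

lemma lift_selfadjoint_norm_le:
  assumes surj: "surj f" and d: "star d = d" "norm d < r"
  obtains y where "f y = d" "star y = y" "norm y \<le> r"
proof -
  have r: "0 < r" using d norm_ge_zero le_less_trans by blast
  obtain y where y: "f y = (1 / r) *\<^sub>R d" "star y = y" "norm y \<le> 1"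
    using lift_selfadjoint_norm_le_one[OF surj, of "(1 / r) *\<^sub>R d"] d r by (auto simp: star_scaleR)
  then show ?thesis using r
    by (intro that[of "r *\<^sub>R y"]) (simp_all add: star_scaleR mult_left_le)
qed

end

section \<open>Extensions by scalars\<close>

text \<open>This is what an extension becomes when its three algebras are unitized.\<close>

locale scalar_extension =
  j: unital_star_hom j + f: unital_star_hom f
  for j :: "'a::cstar_algebra_1 \<Rightarrow> 'e::cstar_algebra_1" and f :: "'e \<Rightarrow> 'b::cstar_algebra_1" +
  assumes inj_j: "inj j" and surj_f: "surj f"
    and range_j: "range j = {x. \<exists>c. f x = c *\<^sub>C 1}"
begin

lemma j_eq_iff [simp]: "j x = j y \<longleftrightarrow> x = y"
  using inj_j by (auto dest: injD)

lemma in_range_j: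
  assumes "f x = c *\<^sub>C 1"
  obtains y where "x = j y"
  using assms range_j by blast

lemma in_range_j_of_real:
  assumes "f x = of_real r"
  obtains y where "x = j y"
  using in_range_j[of x "complex_of_real r"] assms by (metis of_real_def scaleR_scaleC)

lemma j_selfadjoint: "star (j x) = j x \<Longrightarrow> star x = x"
  by (simp flip: j.map_star)

lemma selfadjoint_f_j:
  assumes "star x = x"
  obtains r where "f (j x) = of_real r"
proof -
  obtain c where c: "f (j x) = c *\<^sub>C 1" using range_j by blast
  have "star (f (j x)) = f (j x)" using assms by (simp flip: j.map_star f.map_star)
  then have "cnj c *\<^sub>C 1 = c *\<^sub>C (1::'b)" by (simp add: c star_scaleC)
  then have "(cnj c - c) *\<^sub>C (1::'b) = 0"
    using scaleC_add_left[of "cnj c" "- c" "1::'b"] by (simp add: scaleC_minus_left)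
  then have "cmod (cnj c - c) = 0" using norm_scaleC[of "cnj c - c" "1::'b"] by simp
  then have "c = complex_of_real (Re c)" by (simp add: complex_eq_iff)
  then have "f (j x) = of_real (Re c)" by (metis c of_real_def scaleR_scaleC)
  then show ?thesis by (rule that)
qed

text \<open>The unitary partner \<open>s\<close> of \<open>j g\<close> is found in \<open>E\<close>;
  it has to lie in the range of \<open>j\<close> before the equations can be pulled back. It does,
  because \<open>f s\<close> is a scalar, namely the positive root \<open>q\<close> of
  \<open>1 - r^2\<close>.\<close>

lemma norm_le_norm_j_selfadjoint:
  assumes x: "star x = x"
  shows "norm x \<le> norm (j x)"
proof (rule dense_ge)
  fix c assume c: "norm (j x) < c"
  then have c0: "0 < c" using norm_ge_zero le_less_trans by blast
  define g where "g = (1 / c) *\<^sub>R x"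
  have sg: "star g = g" by (simp add: g_def star_scaleR x)
  have g: "star (j g) = j g" "norm (j g) < 1"
    using sg c c0 by (simp_all flip: j.map_star) (simp add: g_def)
  obtain s where s: "star s = s" "j g * j g + s * s = 1" "j g * s = s * j g" "norm (1 - s) < 1"
    using selfadjoint_unitary_partner[OF g] by metis
  obtain r where r: "f (j g) = of_real r" using selfadjoint_f_j[OF sg] by metis
  have "\<bar>r\<bar> < 1" using f.norm_map_le[of "j g"] g(2) by (simp add: r)
  then have "r\<^sup>2 < 1" by (simp add: abs_square_less_1)
  define q where "q = sqrt (1 - r\<^sup>2)"
  have q: "0 < q" "q * q = 1 - r * r" using \<open>r\<^sup>2 < 1\<close> by (auto simp: q_def power2_eq_square)
  have "of_real r * of_real r + f s * f s = 1" using arg_cong[OF s(2), of f] by (simp add: r)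
  then have "f s * f s = of_real (q * q)" by (simp add: q(2) eq_diff_eq add.commute)
  then have zero: "(f s - of_real q) * (f s + of_real q) = 0"
    using of_real_commute[of q "f s"] by (simp add: left_diff_distrib distrib_left)
  \<comment> \<open>Closeness of \<open>f s\<close> to 1 selects the root: \<open>f s + q\<close> is
    invertible, so the other factor of \<open>zero\<close> vanishes.\<close>
  have "norm (1 - f s) < 1" using f.norm_map_le[of "1 - s"] s(4) by simp
  then have "norm (of_real (1 + q) - (f s + of_real q)) < \<bar>1 + q\<bar>" using q by simp
  then obtain u where "(f s + of_real q) * u = 1" using inverse_near_of_real by metis
  then have "f s = of_real q"
    using arg_cong[OF zero, of "\<lambda>w. w * u"] by (simp add: mult.assoc)
  then obtain k where k: "s = j k" by (rule in_range_j_of_real)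
  have "star k = k" using s(1) unfolding k by (rule j_selfadjoint)
  moreover have "j (g * g + k * k) = j 1" "j (g * k) = j (k * g)"
    using s(2,3) by (simp_all add: k)
  then have "g * g + k * k = 1" "g * k = k * g" unfolding j_eq_iff .
  ultimately have "norm g \<le> 1" by (intro norm_le_one_unitary[OF sg])
  then show "norm x \<le> c" using c0 by (simp add: g_def field_simps)
qed

lemma norm_j [simp]: "norm (j x) = norm x"
proof (rule antisym)
  have "norm (star x * x) \<le> norm (j (star x * x))"
    by (intro norm_le_norm_j_selfadjoint) (simp add: star_mult star_star)
  then have "(norm x)\<^sup>2 \<le> (norm (j x))\<^sup>2" by (simp add: norm_star_mult_self)
  then show "norm x \<le> norm (j x)" by (rule power2_le_imp_le) simp
qed (rule j.norm_map_le)

text \<open>Spectral permanence: if \<open>f (j w)\<close> is a scalar, so is the image of the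
  inverse of \<open>j w\<close>, which therefore lies in the range of \<open>j\<close>.\<close>

lemma j_reflects_inverse:
  assumes u: "j w * u = 1" "u * j w = 1"
  obtains v where "w * v = 1" "v * w = 1"
proof -
  obtain c where c: "f (j w) = c *\<^sub>C 1" using range_j by blast
  have cu: "c *\<^sub>C f u = 1" using arg_cong[OF u(1), of f] by (simp add: c mult_scaleC_left)
  then have "c \<noteq> 0" by auto
  then have "f u = inverse c *\<^sub>C 1" by (simp add: scaleC_scaleC flip: cu)
  then obtain v where v: "u = j v" by (rule in_range_j)
  have "j (w * v) = j 1" "j (v * w) = j 1" using u by (simp_all add: v)
  then show ?thesis using that unfolding j_eq_iff by blast
qed

end

section \<open>Density\<close>

lemma Lg_sa_dense_iff:
  "Lg_sa_dense TYPE('a::cstar_algebra) n \<longleftrightarrow>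
     (\<forall>a e. 0 < e \<and> (\<forall>k<n. star (a k) = a k) \<longrightarrow>
       (\<exists>b. (\<forall>k<n. star (b k) = b k \<and> norm (b k - a k) < e) \<and>
          is_invertible (\<Sum>k<n. b k * b k :: 'a)))" (is "_ \<longleftrightarrow> ?R")
proof -
  define X where "X = product_topology (\<lambda>_::nat. top_of_set (self_adjoints :: 'a set)) {..<n}"
  have top: "topspace X = {..<n} \<rightarrow>\<^sub>E self_adjoints" by (simp add: X_def topspace_product_topology)
  have dense_iff: "Lg_sa_dense TYPE('a) n \<longleftrightarrow> X closure_of Lg_sa n = topspace X"
    unfolding Lg_sa_dense_def top by (simp only: X_def)
  show ?thesis
  proof
    assume "Lg_sa_dense TYPE('a) n"
    then have dense: "X closure_of Lg_sa n = topspace X" unfolding dense_iff .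
    show ?R
    proof (intro allI impI)
      fix a :: "nat \<Rightarrow> 'a" and e :: real
      assume e: "0 < e \<and> (\<forall>k<n. star (a k) = a k)"
      define U where "U = (\<Pi>\<^sub>E k\<in>{..<n}. self_adjoints \<inter> ball (a k) e)"
      have "openin X U" unfolding X_def U_def
        by (subst openin_PiE_gen) (auto intro: openin_open_Int)
      moreover have "restrict a {..<n} \<in> U" using e by (auto simp: U_def self_adjoints_def)
      moreover have "restrict a {..<n} \<in> topspace X" using e by (auto simp: top self_adjoints_def)
      ultimately obtain b where b: "b \<in> Lg_sa n" "b \<in> U"
        using dense unfolding closure_of_def by blast
      have "star (b k) = b k \<and> norm (b k - a k) < e" if "k < n" for k
        using PiE_mem[OF b(2)[unfolded U_def], of k] that
        by (auto simp: self_adjoints_def dist_norm norm_minus_commute)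
      then show "\<exists>b. (\<forall>k<n. star (b k) = b k \<and> norm (b k - a k) < e) \<and>
          is_invertible (\<Sum>k<n. b k * b k)" using b(1) by (auto simp: Lg_sa_def)
    qed
  next
    assume R: ?R
    have "topspace X \<subseteq> X closure_of Lg_sa n"
    proof
      fix a assume a: "a \<in> topspace X"
      have "\<exists>b. b \<in> Lg_sa n \<and> b \<in> T" if T: "a \<in> T" "openin X T" for T
      proof -
        obtain U where U: "\<And>k. k < n \<Longrightarrow> openin (top_of_set self_adjoints) (U k)"
          "a \<in> (\<Pi>\<^sub>E k\<in>{..<n}. U k)" "(\<Pi>\<^sub>E k\<in>{..<n}. U k) \<subseteq> T"
          using product_topology_open_contains_basis[OF T(2)[unfolded X_def] T(1)] by auto
        have "\<exists>e>0. \<forall>y. star y = y \<and> norm (y - a k) < e \<longrightarrow> y \<in> U k" if k: "k < n" for k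
        proof -
          have "a k \<in> U k" using U(2) k by auto
          then obtain e where "0 < e" "ball (a k) e \<inter> self_adjoints \<subseteq> U k"
            using U(1)[OF k] unfolding openin_contains_ball by blast
          then show ?thesis
            by (intro exI[of _ e]) (auto simp: self_adjoints_def dist_norm norm_minus_commute)
        qed
        then obtain E where E: "\<And>k. k < n \<Longrightarrow> 0 < E k"
          "\<And>k y. k < n \<Longrightarrow> star y = y \<Longrightarrow> norm (y - a k) < E k \<Longrightarrow> y \<in> U k" by metis
        \<comment> \<open>The inserted 1 keeps the set nonempty when \<open>n = 0\<close>.\<close>
        define e where "e = Min (insert 1 (E ` {..<n}))"
        have e: "0 < e" "\<And>k. k < n \<Longrightarrow> e \<le> E k" using E(1) by (auto simp: e_def)
        have "\<forall>k<n. star (a k) = a k" using a by (auto simp: top self_adjoints_def)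
        then obtain b where b: "\<And>k. k < n \<Longrightarrow> star (b k) = b k \<and> norm (b k - a k) < e"
          "is_invertible (\<Sum>k<n. b k * b k)" using R e(1) by blast
        have bU: "b k \<in> U k" if "k < n" for k
          using b(1)[OF that] e(2)[OF that] by (intro E(2)[OF that]) auto
        have "restrict b {..<n} \<in> Lg_sa n"
          using b by (auto simp: Lg_sa_def self_adjoints_def)
        moreover have "restrict b {..<n} \<in> (\<Pi>\<^sub>E k\<in>{..<n}. U k)"
          using bU by simp
        ultimately show ?thesis using U(3) by blast
      qed
      then show "a \<in> X closure_of Lg_sa n" using a by (simp add: in_closure_of)
    qed
    then have "X closure_of Lg_sa n = topspace X" by (intro equalityI closure_of_subset_topspace)
    then show "Lg_sa_dense TYPE('a) n" unfolding dense_iff .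
  qed
qed

lemma is_identity_iff_one: "is_identity e \<longleftrightarrow> e = (1 :: 'a::cstar_algebra_1)"
  by (metis is_identity_def mult_1_left mult_1_right)

lemma is_invertible_iff: "is_invertible x \<longleftrightarrow> (\<exists>y. x * y = 1 \<and> y * x = (1 :: 'a::cstar_algebra_1))"
  by (simp add: is_invertible_def is_identity_iff_one)

lemma is_invertible_sum_squares:
  fixes x :: "'i \<Rightarrow> 'a::cstar_algebra_1"
  assumes "finite A" "\<And>k. k \<in> A \<Longrightarrow> star (x k) = x k" "1 \<in> left_combinations x A"
  shows "is_invertible (\<Sum>k\<in>A. x k * x k)"
  using sum_squares_invertible[OF assms] is_invertible_iff by metis

lemma Lg_sa_dense_obtain:
  assumes "Lg_sa_dense TYPE('a::cstar_algebra) n" "0 < e" "\<And>k. k < n \<Longrightarrow> star (a k) = (a k :: 'a)"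
  obtains b where "\<And>k. k < n \<Longrightarrow> star (b k) = b k" "\<And>k. k < n \<Longrightarrow> norm (b k - a k) < e"
    "is_invertible (\<Sum>k<n. b k * b k)"
proof -
  have "0 < e \<and> (\<forall>k<n. star (a k) = a k)" using assms(2,3) by blast
  then show ?thesis using assms(1) that unfolding Lg_sa_dense_iff by metis
qed

lemma Lg_sa_denseI:
  assumes "\<And>(a :: nat \<Rightarrow> 'a::cstar_algebra) e. 0 < e \<Longrightarrow> (\<And>k. k < n \<Longrightarrow> star (a k) = a k) \<Longrightarrow>
     \<exists>b. (\<forall>k<n. star (b k) = b k \<and> norm (b k - a k) < e) \<and> is_invertible (\<Sum>k<n. b k * b k)"
  shows "Lg_sa_dense TYPE('a) n"
  unfolding Lg_sa_dense_iff using assms by blast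

section \<open>Density in quotients, extensions and ideals\<close>

context scalar_extension
begin

lemma Lg_sa_dense_quotient:
  assumes "Lg_sa_dense TYPE('e) n"
  shows "Lg_sa_dense TYPE('b) n"
proof (rule Lg_sa_denseI)
  fix d :: "nat \<Rightarrow> 'b" and \<epsilon> :: real
  assume \<epsilon>: "0 < \<epsilon>" and d: "\<And>k. k < n \<Longrightarrow> star (d k) = d k"
  have "\<exists>x. f x = d k \<and> star x = x" if "k < n" for k
    using f.lift_selfadjoint[of "inv f (d k)" "d k"] surj_f d[OF that] by (metis surj_f_inv_f)
  then obtain x where x: "\<And>k. k < n \<Longrightarrow> f (x k) = d k" "\<And>k. k < n \<Longrightarrow> star (x k) = x k" by metis
  obtain y where y: "\<And>k. k < n \<Longrightarrow> star (y k) = y k" "\<And>k. k < n \<Longrightarrow> norm (y k - x k) < \<epsilon>"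
    "is_invertible (\<Sum>k<n. y k * y k)"
    using Lg_sa_dense_obtain[where a = x, OF assms \<epsilon> x(2)] by blast
  obtain u where u: "(\<Sum>k<n. y k * y k) * u = 1" "u * (\<Sum>k<n. y k * y k) = 1"
    using y(3) unfolding is_invertible_iff by blast
  have "is_invertible (\<Sum>k<n. f (y k) * f (y k))"
    unfolding is_invertible_iff using arg_cong[OF u(1), of f] arg_cong[OF u(2), of f]
    by (auto simp: f.map_sum)
  moreover have "star (f (y k)) = f (y k) \<and> norm (f (y k) - d k) < \<epsilon>" if k: "k < n" for k
    using f.norm_map_le[of "y k - x k"] y(1,2)[OF k] x(1)[OF k] by (simp flip: f.map_star)
  ultimately show "\<exists>b. (\<forall>k<n. star (b k) = b k \<and> norm (b k - d k) < \<epsilon>) \<and> is_invertible (\<Sum>k<n. b k * b k)"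
    by (intro exI[of _ "\<lambda>k. f (y k)"]) simp
qed

lemma Lg_sa_dense_extension:
  assumes A: "Lg_sa_dense TYPE('a) m" and B: "Lg_sa_dense TYPE('b) n"
  shows "Lg_sa_dense TYPE('e) (n + m)"
proof (rule Lg_sa_denseI)
  fix x :: "nat \<Rightarrow> 'e" and \<epsilon> :: real
  assume \<epsilon>: "0 < \<epsilon>" and x: "\<And>k. k < n + m \<Longrightarrow> star (x k) = x k"
  have x1: "star (f (x k)) = f (x k)" if "k < n" for k
    using x[of k] that by (simp flip: f.map_star)
  have e2: "0 < \<epsilon> / 2" using \<epsilon> by simp
  obtain \<beta> where \<beta>: "\<And>k. k < n \<Longrightarrow> star (\<beta> k) = \<beta> k"
      "\<And>k. k < n \<Longrightarrow> norm (\<beta> k - f (x k)) < \<epsilon> / 2" and \<beta>_inv: "is_invertible (\<Sum>k<n. \<beta> k * \<beta> k)"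
    using Lg_sa_dense_obtain[where a = "\<lambda>k. f (x k)", OF B e2 x1] by blast
  have "\<exists>y. f y = \<beta> k - f (x k) \<and> star y = y \<and> norm y \<le> \<epsilon> / 2" if k: "k < n" for k
    using f.lift_selfadjoint_norm_le[OF surj_f, of "\<beta> k - f (x k)"] \<beta>(2)[OF k]
    by (metis star_diff \<beta>(1)[OF k] x1[OF k])
  then obtain p where p: "\<And>k. k < n \<Longrightarrow> f (p k) = \<beta> k - f (x k)" "\<And>k. k < n \<Longrightarrow> star (p k) = p k"
    "\<And>k. k < n \<Longrightarrow> norm (p k) \<le> \<epsilon> / 2" by metis
  define s where "s = (\<Sum>k<n. (x k + p k) * (x k + p k))"
  have ss: "star s = s" by (simp add: s_def star_sum star_mult star_add x p)
  have fs: "f s = (\<Sum>k<n. \<beta> k * \<beta> k)" by (simp add: s_def f.map_sum p)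
  then obtain \<gamma> where \<gamma>: "f s * \<gamma> = 1" "\<gamma> * f s = 1" using \<beta>_inv unfolding is_invertible_iff by auto
  have "star (f s) = f s" by (simp add: ss flip: f.map_star)
  then have "star \<gamma> = \<gamma>" using star_inverse \<gamma> by blast
  then obtain y where y: "f y = \<gamma>" "star y = y"
    using surj_f f.lift_selfadjoint[of "inv f \<gamma>" \<gamma>] by (auto simp: surj_f_inv_f)
  \<comment> \<open>\<open>f (g k) = f (x k)\<close> because \<open>\<gamma>\<close> inverts
    \<open>f s\<close>, and the factor \<open>s\<close> on the right puts \<open>g k\<close> into
    every left ideal containing \<open>s\<close>.\<close>
  define g where "g k = s * (y * x k * y) * s" for k
  have sg: "star (g k) = g k" if "k < n + m" for k
    by (simp add: g_def star_mult ss y x[OF that] mult.assoc)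
  have "\<exists>h. x k - g k = j h" for k
  proof -
    have "f (g k) = (f s * \<gamma>) * f (x k) * (\<gamma> * f s)" by (simp add: g_def y mult.assoc)
    then have "f (x k - g k) = of_real 0" by (simp add: \<gamma>)
    then show ?thesis using in_range_j_of_real by metis
  qed
  then obtain h where h: "\<And>k. x k - g k = j (h k)" by metis
  have sh: "star (h (n + k)) = h (n + k)" if "k < m" for k
    using that by (intro j_selfadjoint) (simp flip: h add: star_diff x sg)
  obtain c where c: "\<And>k. k < m \<Longrightarrow> star (c k) = c k" "\<And>k. k < m \<Longrightarrow> norm (c k - h (n + k)) < \<epsilon>"
    and c_inv: "is_invertible (\<Sum>k<m. c k * c k)"
    using Lg_sa_dense_obtain[where a = "\<lambda>k. h (n + k)", OF A \<epsilon> sh] by blast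
  obtain v where v: "v * (\<Sum>k<m. c k * c k) = 1" using c_inv unfolding is_invertible_iff by auto
  \<comment> \<open>The first \<open>n\<close> entries take care of the quotient; the last
    \<open>m\<close> use the tuple \<open>c\<close> perturbed inside the ideal, whence the shift
    \<open>k - n\<close>.\<close>
  define w where "w k = (if k < n then x k + p k else j (c (k - n)) + g k)" for k
  have sw: "star (w k) = w k" if "k < n + m" for k
    using that c(1)[of "k - n"] by (auto simp: w_def star_add x p sg simp flip: j.map_star)
  have nw: "norm (w k - x k) < \<epsilon>" if k: "k < n + m" for k
  proof (cases "k < n")
    case True
    then show ?thesis using p(3)[OF True] \<epsilon> by (simp add: w_def)
  next
    case False
    then have "w k - x k = j (c (k - n) - h k)" using h[of k] by (simp add: w_def algebra_simps)
    then show ?thesis using c(2)[of "k - n"] False k by (simp del: j.map_diff)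
  qed
  let ?L = "left_combinations w {..<n + m}"
  have w: "w k \<in> ?L" if "k < n + m" for k
    using that by (intro left_combinations_generator) auto
  have "(x k + p k) * (x k + p k) \<in> ?L" if "k < n" for k
    using w[of k] that by (intro left_combinations_mult) (simp add: w_def)
  then have s: "s \<in> ?L" unfolding s_def by (intro left_combinations_sum) auto
  have "j (c k) \<in> ?L" if "k < m" for k
  proof -
    have "j (c k) = w (n + k) - (s * (y * x (n + k) * y)) * s" by (simp add: w_def g_def)
    then show ?thesis
      using left_combinations_diff[OF w[of "n + k"] left_combinations_mult[OF s]] that by simp
  qed
  then have "j v * (\<Sum>k<m. j (c k) * j (c k)) \<in> ?L"
    by (intro left_combinations_mult left_combinations_sum) auto
  moreover have "j v * (\<Sum>k<m. j (c k) * j (c k)) = 1"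
    using arg_cong[OF v, of j] by (simp add: j.map_sum)
  ultimately have "is_invertible (\<Sum>k<n + m. w k * w k)"
    using sw by (intro is_invertible_sum_squares) auto
  then show "\<exists>b. (\<forall>k<n + m. star (b k) = b k \<and> norm (b k - x k) < \<epsilon>) \<and> is_invertible (\<Sum>k<n + m. b k * b k)"
    using sw nw by (intro exI[of _ w]) simp
qed

lemma Lg_sa_dense_ideal:
  assumes E: "Lg_sa_dense TYPE('e) (n + 1)"
  shows "Lg_sa_dense TYPE('a) (n + 1)"
proof (rule Lg_sa_denseI)
  fix a :: "nat \<Rightarrow> 'a" and \<epsilon> :: real
  assume \<epsilon>: "0 < \<epsilon>" and a: "\<And>k. k < n + 1 \<Longrightarrow> star (a k) = a k"
  have "\<exists>l. f (j (a k)) = of_real l" if "k < n + 1" for k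
    using selfadjoint_f_j[OF a[OF that]] by metis
  then obtain l where l: "\<And>k. k < n + 1 \<Longrightarrow> f (j (a k)) = of_real (l k)" by metis
  \<comment> \<open>Pushes the scalar of entry 0 away from 0 in the direction of its sign, so that
    \<open>\<bar>L 0\<bar> \<ge> \<epsilon> / 2\<close> and \<open>f (y 0)\<close> becomes
    invertible.\<close>
  define \<mu> where "\<mu> k = (if k = 0 then if 0 \<le> l 0 then \<epsilon> / 2 else - (\<epsilon> / 2) else 0)" for k :: nat
  define p where "p k = j (a k) + of_real (\<mu> k)" for k
  define L where "L k = l k + \<mu> k" for k
  have \<mu>: "\<bar>\<mu> k\<bar> \<le> \<epsilon> / 2" for k using \<epsilon> by (simp add: \<mu>_def)
  have L0: "\<epsilon> / 2 \<le> \<bar>L 0\<bar>" using \<epsilon> by (simp add: L_def \<mu>_def)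
  have fp: "f (p k) = of_real (L k)" if "k < n + 1" for k by (simp add: p_def l[OF that] L_def)
  have sp: "star (p k) = p k" if "k < n + 1" for k
    by (simp add: p_def star_add a[OF that] flip: j.map_star)
  define P where "P = norm (p 0) + 1"
  have P: "1 \<le> P" by (simp add: P_def)
  \<comment> \<open>\<open>\<kappa>\<close> bounds \<open>y 0 * t k * y 0\<close>. The total error
    is below \<open>\<epsilon> / 8 + \<epsilon> / 4 + \<epsilon> / 2\<close>, from
    \<open>\<delta>\<close>, \<open>\<kappa>\<close> and \<open>\<mu>\<close>; the bound
    \<open>1 / 2\<close> serves to invert \<open>1 - y 0 * t 0\<close>.\<close>
  define \<kappa> where "\<kappa> = min (\<epsilon> / 4) (1 / 2)"
  have \<kappa>: "0 < \<kappa>" "\<kappa> \<le> \<epsilon> / 4" "\<kappa> \<le> 1 / 2" using \<epsilon> by (auto simp: \<kappa>_def)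
  \<comment> \<open>Solves \<open>P^2 * r \<le> \<kappa>\<close>, where
    \<open>r = (4 / \<epsilon>)^2 * \<delta>\<close> will bound the lifts \<open>t k\<close> and
    \<open>P\<close> will bound \<open>y 0\<close>.\<close>
  define \<delta> where "\<delta> = min (\<epsilon> / 8) (min 1 (\<kappa> * \<epsilon>\<^sup>2 / (16 * P\<^sup>2)))"
  have \<delta>: "0 < \<delta>" "\<delta> \<le> \<epsilon> / 8" "\<delta> \<le> 1" using \<epsilon> \<kappa>(1) P by (auto simp: \<delta>_def)
  define r where "r = (4 / \<epsilon>)\<^sup>2 * \<delta>"
  have r: "P * P * r \<le> \<kappa>"
  proof -
    have "\<delta> \<le> \<kappa> * \<epsilon>\<^sup>2 / (16 * P\<^sup>2)" by (simp add: \<delta>_def)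
    then have "P\<^sup>2 * r \<le> P\<^sup>2 * ((4 / \<epsilon>)\<^sup>2 * (\<kappa> * \<epsilon>\<^sup>2 / (16 * P\<^sup>2)))"
      unfolding r_def by (intro mult_left_mono) auto
    also have "\<dots> = \<kappa>" using \<epsilon> P by (simp add: power_divide)
    finally show ?thesis by (simp add: power2_eq_square)
  qed
  have r0: "0 < r" using \<epsilon> \<delta> by (simp add: r_def)
  obtain y where y: "\<And>k. k < n + 1 \<Longrightarrow> star (y k) = y k" "\<And>k. k < n + 1 \<Longrightarrow> norm (y k - p k) < \<delta>"
    and y_inv: "is_invertible (\<Sum>k<n + 1. y k * y k)"
    using Lg_sa_dense_obtain[where a = p, OF E \<delta>(1) sp] by blast
  have fy: "norm (f (y k) - of_real (L k)) < \<delta>" if k: "k < n + 1" for k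
    using f.norm_map_le[of "y k - p k"] y(2)[OF k] fp[OF k] by simp
  have sfy: "star (f (y k)) = f (y k)" if k: "k < n + 1" for k
    by (simp add: y(1)[OF k] flip: f.map_star)
  \<comment> \<open>\<open>f (y 0)\<close> stays within \<open>\<epsilon> / 4\<close> of a scalar of
    modulus at least \<open>\<epsilon> / 2\<close>, so its inverse has norm at most
    \<open>4 / \<epsilon>\<close>.\<close>
  have "norm (of_real (L 0) - f (y 0)) < \<epsilon> / 4"
    using fy[of 0] \<delta> \<epsilon> by (simp add: norm_minus_commute)
  then have near: "\<epsilon> / 4 < \<bar>L 0\<bar> - norm (of_real (L 0) - f (y 0))" using L0 by linarith
  then have "norm (of_real (L 0) - f (y 0)) < \<bar>L 0\<bar>" using \<epsilon> by linarith
  then obtain \<gamma> where \<gamma>: "f (y 0) * \<gamma> = 1" "\<gamma> * f (y 0) = 1"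
    "norm \<gamma> \<le> 1 / (\<bar>L 0\<bar> - norm (of_real (L 0) - f (y 0)))"
    by (rule inverse_near_of_real)
  have n\<gamma>: "norm \<gamma> \<le> 4 / \<epsilon>"
    using \<gamma>(3) near \<epsilon> by (elim order_trans) (simp add: field_simps)
  have s\<gamma>: "star \<gamma> = \<gamma>" using star_inverse[OF \<gamma>(1,2)] sfy[of 0] by simp
  have "\<exists>t. f t = \<gamma> * (f (y k) - of_real (L k)) * \<gamma> \<and> star t = t \<and> norm t \<le> r" if k: "k < n + 1" for k
  proof -
    have "norm (\<gamma> * (f (y k) - of_real (L k)) * \<gamma>) \<le> norm \<gamma> * norm (f (y k) - of_real (L k)) * norm \<gamma>"
      by (intro order_trans[OF norm_mult_ineq] mult_right_mono norm_mult_ineq) auto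
    also have "\<dots> \<le> (4 / \<epsilon>) * norm (f (y k) - of_real (L k)) * (4 / \<epsilon>)"
      using \<epsilon> by (intro mult_mono n\<gamma>) auto
    also have "\<dots> = (4 / \<epsilon>)\<^sup>2 * norm (f (y k) - of_real (L k))" by (simp add: power2_eq_square)
    also have "\<dots> < r" unfolding r_def using fy[OF k] \<epsilon> by (intro mult_strict_left_mono) auto
    finally show ?thesis
      using f.lift_selfadjoint_norm_le[OF surj_f, of "\<gamma> * (f (y k) - of_real (L k)) * \<gamma>" r]
      by (metis star_mult star_diff s\<gamma> sfy[OF k] star_of_real mult.assoc)
  qed
  then obtain t where t: "\<And>k. k < n + 1 \<Longrightarrow> f (t k) = \<gamma> * (f (y k) - of_real (L k)) * \<gamma>"
    "\<And>k. k < n + 1 \<Longrightarrow> star (t k) = t k" "\<And>k. k < n + 1 \<Longrightarrow> norm (t k) \<le> r" by metis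
  \<comment> \<open>Conjugating \<open>t k\<close> by \<open>y 0\<close> cancels both factors
    \<open>\<gamma>\<close> under \<open>f\<close>, leaving \<open>f (z k)\<close> equal to the
    scalar \<open>L k\<close>.\<close>
  define z where "z k = y k - y 0 * t k * y 0" for k
  have sz: "star (z k) = z k" if k: "k < n + 1" for k
    by (simp add: z_def star_diff star_mult y(1)[OF k] y(1)[of 0] t(2)[OF k] mult.assoc)
  have fz: "f (z k) = of_real (L k)" if k: "k < n + 1" for k
  proof -
    have "f (y 0) * f (t k) * f (y 0) = (f (y 0) * \<gamma>) * (f (y k) - of_real (L k)) * (\<gamma> * f (y 0))"
      by (simp only: t(1)[OF k] mult.assoc)
    then show ?thesis by (simp add: z_def \<gamma>)
  qed
  have "\<exists>b. z k = j b" if "k < n + 1" for k using in_range_j_of_real[OF fz[OF that]] by metis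
  then obtain b where b: "\<And>k. k < n + 1 \<Longrightarrow> z k = j (b k)" by metis
  have sb: "star (b k) = b k" if k: "k < n + 1" for k
    using sz[OF k] unfolding b[OF k] by (rule j_selfadjoint)
  have ny: "norm (y 0) \<le> P"
    using norm_triangle_ineq[of "y 0 - p 0" "p 0"] y(2)[of 0] \<delta> by (simp add: P_def)
  have yt: "norm (y 0 * t k) \<le> P * r" if k: "k < n + 1" for k
    using ny t(3)[OF k] P by (intro order_trans[OF norm_mult_ineq] mult_mono) auto
  have nb: "norm (b k - a k) < \<epsilon>" if k: "k < n + 1" for k
  proof -
    have "norm (y 0 * t k * y 0) \<le> (P * r) * P"
      using ny t(3)[OF k] P r0 by (intro order_trans[OF norm_mult_ineq] mult_mono) auto
    then have 1: "norm (y 0 * t k * y 0) \<le> \<epsilon> / 4" using r \<kappa> by (simp add: mult.commute mult.left_commute)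
    have "norm (b k - a k) = norm (j (b k - a k))" by (simp del: j.map_diff)
    also have "j (b k - a k) = (y k - p k) - y 0 * t k * y 0 + of_real (\<mu> k)"
      by (simp add: p_def z_def flip: b[OF k])
    also have "norm \<dots> \<le> norm (y k - p k) + norm (y 0 * t k * y 0) + \<bar>\<mu> k\<bar>"
      using norm_triangle_ineq[of "(y k - p k) - y 0 * t k * y 0" "of_real (\<mu> k)"]
        norm_triangle_ineq4[of "y k - p k" "y 0 * t k * y 0"] by simp
    also have "\<dots> < \<epsilon>" using y(2)[OF k] 1 \<mu>[of k] \<delta> \<epsilon> by linarith
    finally show ?thesis .
  qed
  \<comment> \<open>As \<open>P \<ge> 1\<close>, the bound \<open>P * r\<close> on
    \<open>y 0 * t 0\<close> is at most \<open>\<kappa> \<le> 1 / 2\<close>.\<close>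
  have "1 * (P * r) \<le> P * (P * r)" using P r0 by (intro mult_right_mono) auto
  then have "norm (y 0 * t 0) < 1" using yt[of 0] r \<kappa> by (simp add: mult.assoc)
  then obtain g where g: "g * (1 - y 0 * t 0) = 1" using neumann_inverse by metis
  let ?L = "left_combinations z {..<n + 1}"
  have z: "z k \<in> ?L" if "k < n + 1" for k
    using that by (intro left_combinations_generator) auto
  have "z 0 = (1 - y 0 * t 0) * y 0" by (simp add: z_def left_diff_distrib)
  then have "g * z 0 = y 0" using g by (simp flip: mult.assoc)
  then have y0: "y 0 \<in> ?L" using left_combinations_mult[OF z[of 0], of g] by simp
  have "y k \<in> ?L" if k: "k < n + 1" for k
    using left_combinations_add[OF z[OF k] left_combinations_mult[OF y0, of "y 0 * t k"]]
    by (simp add: z_def)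
  then have sum_y: "(\<Sum>k<n + 1. y k * y k) \<in> ?L"
    by (intro left_combinations_mult left_combinations_sum) auto
  obtain v where "v * (\<Sum>k<n + 1. y k * y k) = 1" using y_inv unfolding is_invertible_iff by metis
  then have "1 \<in> ?L" using left_combinations_mult[OF sum_y, of v] by metis
  then have "is_invertible (\<Sum>k<n + 1. z k * z k)"
    using sz by (intro is_invertible_sum_squares) auto
  moreover have "(\<Sum>k<n + 1. z k * z k) = j (\<Sum>k<n + 1. b k * b k)"
    unfolding j.map_sum by (intro sum.cong refl) (simp add: b)
  ultimately obtain u where u: "j (\<Sum>k<n + 1. b k * b k) * u = 1" "u * j (\<Sum>k<n + 1. b k * b k) = 1"
    unfolding is_invertible_iff by metis
  have "is_invertible (\<Sum>k<n + 1. b k * b k)"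
    using j_reflects_inverse[OF u] unfolding is_invertible_iff by blast
  then show "\<exists>b. (\<forall>k<n + 1. star (b k) = b k \<and> norm (b k - a k) < \<epsilon>) \<and> is_invertible (\<Sum>k<n + 1. b k * b k)"
    using sb nb by (intro exI[of _ b]) simp
qed

end

section \<open>Unitizations\<close>

instantiation unitization :: (cstar_algebra) one
begin

definition "1 = Unitization 0 1"

instance ..

end

instance unitization :: (cstar_algebra) cstar_algebra_1
proof
  fix p :: "'a unitization"
  show "1 * p = p" "p * 1 = p"
    using is_identity_unitization[where 'a = 'a] by (simp_all add: is_identity_def one_unitization_def)
  show "(0 :: 'a unitization) \<noteq> 1" by (simp add: zero_unitization_def one_unitization_def)
  have "unitization_opnorm (1 :: 'a unitization) \<le> 1"
    by (rule unitization_opnorm_least) (simp add: unitization_act_def one_unitization_def)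
  then show "norm (1 :: 'a unitization) = 1" by (simp add: norm_unitization_def one_unitization_def)
qed

lemma scaleC_one_unitization: "c *\<^sub>C 1 = (Unitization 0 c :: 'a::cstar_algebra unitization)"
  by (simp add: scaleC_unitization_def one_unitization_def)

definition map_algebra_part :: "('a \<Rightarrow> 'b) \<Rightarrow> 'a unitization \<Rightarrow> 'b unitization" where
  "map_algebra_part f p = Unitization (f (algebra_part p)) (scalar_part p)"

lemma star_hom_zero: "star_hom f \<Longrightarrow> f 0 = 0"
  unfolding star_hom_def by (metis scaleC_zero_left)

lemma unital_star_hom_map_algebra_part:
  assumes f: "star_hom f"
  shows "unital_star_hom (map_algebra_part f)"
proof
  show "map_algebra_part f 1 = 1"
    by (simp add: map_algebra_part_def one_unitization_def star_hom_zero[OF f])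
  show "star_hom (map_algebra_part f)"
    using f by (simp add: star_hom_def map_algebra_part_def unitization_defs)
qed

text \<open>An element of the unitized \<open>E\<close> goes to a scalar exactly when
  \<open>\<pi>\<close> kills its algebra part; exactness then places that part in the range of
  \<open>\<iota>\<close>.\<close>

lemma scalar_extension_unitization:
  assumes "cstar_extension \<iota> \<pi>"
  shows "scalar_extension (map_algebra_part \<iota>) (map_algebra_part \<pi>)"
proof -
  from assms have ext: "star_hom \<iota>" "star_hom \<pi>" "inj \<iota>" "range \<iota> = {x. \<pi> x = 0}" "surj \<pi>"
    by (auto simp: cstar_extension_def)
  interpret i: unital_star_hom "map_algebra_part \<iota>"
    by (rule unital_star_hom_map_algebra_part) fact
  interpret p: unital_star_hom "map_algebra_part \<pi>"
    by (rule unital_star_hom_map_algebra_part) fact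
  show ?thesis
  proof
    show "inj (map_algebra_part \<iota>)"
      using ext(3) by (auto simp: inj_def map_algebra_part_def unitization.expand)
    show "surj (map_algebra_part \<pi>)"
    proof (rule surjI)
      show "map_algebra_part \<pi> (Unitization (inv \<pi> (algebra_part q)) (scalar_part q)) = q" for q
        by (simp add: map_algebra_part_def surj_f_inv_f[OF ext(5)])
    qed
    show "range (map_algebra_part \<iota>) = {x. \<exists>c. map_algebra_part \<pi> x = c *\<^sub>C 1}"
    proof (intro equalityI subsetI)
      fix x assume "x \<in> range (map_algebra_part \<iota>)"
      then obtain p where "x = map_algebra_part \<iota> p" by blast
      moreover have "\<pi> (\<iota> (algebra_part p)) = 0" using ext(4) by blast
      ultimately show "x \<in> {x. \<exists>c. map_algebra_part \<pi> x = c *\<^sub>C 1}"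
        by (simp add: map_algebra_part_def scaleC_one_unitization)
    next
      fix x assume "x \<in> {x. \<exists>c. map_algebra_part \<pi> x = c *\<^sub>C 1}"
      then have "algebra_part x \<in> range \<iota>"
        by (auto simp: map_algebra_part_def scaleC_one_unitization ext(4))
      then obtain a where "algebra_part x = \<iota> a" by blast
      then have "x = map_algebra_part \<iota> (Unitization a (scalar_part x))"
        by (simp add: map_algebra_part_def unitization.expand)
      then show "x \<in> range (map_algebra_part \<iota>)" by blast
    qed
  qed
qed

text \<open>If \<open>e\<close> is an identity of the algebra, its unitization is the direct sum of the algebra and the
  scalars, through \<open>p \<mapsto> (unit_part e p, scalar_part p)\<close>.\<close>

definition unit_part :: "'a::cstar_algebra \<Rightarrow> 'a unitization \<Rightarrow> 'a" where
  "unit_part e p = algebra_part p + scalar_part p *\<^sub>C e"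

context
  fixes e :: "'a::cstar_algebra"
  assumes e: "is_identity e"
begin

lemma identity_mult [simp]: "e * x = x" "x * e = x"
  using e by (simp_all add: is_identity_def)

lemma identity_star [simp]: "star e = e"
  by (metis identity_mult star_mult star_star)

lemma is_identity_iff: "is_identity x \<longleftrightarrow> x = e"
  using e by (metis identity_mult(1) is_identity_def)

lemma unit_part_mult: "unit_part e (p * q) = unit_part e p * unit_part e q"
  by (simp add: unit_part_def times_unitization_def distrib_left distrib_right scaleC_add_right
      mult_scaleC_left mult_scaleC_right scaleC_scaleC add.assoc mult.commute)

lemma unit_part_diff: "unit_part e (p - q) = unit_part e p - unit_part e q"
  using scaleC_add_left[of "scalar_part p" "- scalar_part q" e]
  by (simp add: unit_part_def minus_unitization_def scaleC_minus_left)

lemma unit_part_add: "unit_part e (p + q) = unit_part e p + unit_part e q"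
  by (simp add: unit_part_def plus_unitization_def scaleC_add_left)

lemma unit_part_star: "unit_part e (star p) = star (unit_part e p)"
  by (simp add: unit_part_def star_unitization_def star_add star_scaleC)

lemma unit_part_sum: "unit_part e (sum f A) = (\<Sum>a\<in>A. unit_part e (f a))"
proof (induction A rule: infinite_finite_induct)
qed (simp_all add: unit_part_add, simp_all add: unit_part_def zero_unitization_def)

lemma unitization_eq_iff: "p = q \<longleftrightarrow> unit_part e p = unit_part e q \<and> scalar_part p = scalar_part q"
  by (auto simp: unit_part_def unitization.expand)

lemma unitization_cases_unit_part:
  obtains p where "unit_part e p = x" "scalar_part p = c"
  by (rule that[of "Unitization (x - c *\<^sub>C e) c"]) (simp_all add: unit_part_def)

text \<open>In the presence of the identity \<open>e\<close>, \<open>p\<close> acts as left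
  multiplication by its unit part, so the norm is that of a direct sum.\<close>

lemma norm_unit_part: "norm p = max (cmod (scalar_part p)) (norm (unit_part e p))"
proof -
  have "unitization_act p = unitization_act (Unitization (unit_part e p) 0)"
    by (simp add: fun_eq_iff unitization_act_def unit_part_def distrib_right mult_scaleC_left)
  then have "unitization_opnorm p = unitization_opnorm (Unitization (unit_part e p) 0)"
    by (simp add: unitization_opnorm_def)
  then show ?thesis by (simp add: norm_unitization_def unitization_opnorm_algebra)
qed

lemma is_invertible_unitization_iff:
  "is_invertible p \<longleftrightarrow> is_invertible (unit_part e p) \<and> scalar_part p \<noteq> 0"
proof -
  have one: "unit_part e 1 = e" "scalar_part (1 :: 'a unitization) = 1"
    by (simp_all add: unit_part_def one_unitization_def)
  have mult: "scalar_part (p * q) = scalar_part p * scalar_part q" for p q :: "'a unitization"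
    by (simp add: times_unitization_def)
  show ?thesis
  proof
    assume "is_invertible p"
    then obtain q where q: "p * q = 1" "q * p = 1" unfolding is_invertible_iff by blast
    then have "unit_part e p * unit_part e q = e" "unit_part e q * unit_part e p = e"
      by (simp_all add: one flip: unit_part_mult)
    moreover have "scalar_part p * scalar_part q = 1" by (simp add: q one flip: mult)
    ultimately show "is_invertible (unit_part e p) \<and> scalar_part p \<noteq> 0"
      unfolding is_invertible_def is_identity_iff by auto
  next
    assume "is_invertible (unit_part e p) \<and> scalar_part p \<noteq> 0"
    then obtain y where y: "unit_part e p * y = e" "y * unit_part e p = e" and nz: "scalar_part p \<noteq> 0"
      unfolding is_invertible_def is_identity_iff by blast
    obtain q where q: "unit_part e q = y" "scalar_part q = inverse (scalar_part p)"
      by (rule unitization_cases_unit_part)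
    have "p * q = 1" "q * p = 1"
      using nz by (simp_all add: unitization_eq_iff unit_part_mult one mult q y)
    then show "is_invertible p" unfolding is_invertible_iff by blast
  qed
qed

text \<open>Invertibility and distance are componentwise in the direct sum. The scalar components of
  a self-adjoint tuple are real, and a nonempty real tuple can be perturbed to have a nonzero sum of
  squares; hence \<open>n + 1\<close>.\<close>

lemma Lg_sa_dense_unitization_iff:
  "Lg_sa_dense TYPE('a unitization) (n + 1) \<longleftrightarrow> Lg_sa_dense TYPE('a) (n + 1)"
proof
  assume D: "Lg_sa_dense TYPE('a unitization) (n + 1)"
  show "Lg_sa_dense TYPE('a) (n + 1)"
  proof (rule Lg_sa_denseI)
    fix a :: "nat \<Rightarrow> 'a" and \<epsilon> :: real
    assume \<epsilon>: "0 < \<epsilon>" and a: "\<And>k. k < n + 1 \<Longrightarrow> star (a k) = a k"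
    have sa: "star (Unitization (a k) 0) = Unitization (a k) 0" if "k < n + 1" for k
      by (simp add: star_unitization_def a[OF that])
    obtain q where q: "\<And>k. k < n + 1 \<Longrightarrow> star (q k) = q k"
      "\<And>k. k < n + 1 \<Longrightarrow> norm (q k - Unitization (a k) 0) < \<epsilon>"
      and q_inv: "is_invertible (\<Sum>k<n + 1. q k * q k)"
      using Lg_sa_dense_obtain[where a = "\<lambda>k. Unitization (a k) 0", OF D \<epsilon> sa] by blast
    have "star (unit_part e (q k)) = unit_part e (q k)" if "k < n + 1" for k
      by (simp add: q(1)[OF that] flip: unit_part_star)
    moreover have "norm (unit_part e (q k) - a k) < \<epsilon>" if "k < n + 1" for k
      using q(2)[OF that] unfolding norm_unit_part unit_part_diff by (simp add: unit_part_def)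
    moreover have "is_invertible (\<Sum>k<n + 1. unit_part e (q k) * unit_part e (q k))"
      using q_inv by (simp only: is_invertible_unitization_iff unit_part_sum unit_part_mult)
    ultimately show "\<exists>b. (\<forall>k<n + 1. star (b k) = b k \<and> norm (b k - a k) < \<epsilon>) \<and>
        is_invertible (\<Sum>k<n + 1. b k * b k)"
      by (intro exI[of _ "\<lambda>k. unit_part e (q k)"]) simp
  qed
next
  assume D: "Lg_sa_dense TYPE('a) (n + 1)"
  show "Lg_sa_dense TYPE('a unitization) (n + 1)"
  proof (rule Lg_sa_denseI)
    fix p :: "nat \<Rightarrow> 'a unitization" and \<epsilon> :: real
    assume \<epsilon>: "0 < \<epsilon>" and p: "\<And>k. k < n + 1 \<Longrightarrow> star (p k) = p k"
    have sa: "star (unit_part e (p k)) = unit_part e (p k)" if "k < n + 1" for k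
      by (simp add: p[OF that] flip: unit_part_star)
    obtain b where b: "\<And>k. k < n + 1 \<Longrightarrow> star (b k) = b k"
      "\<And>k. k < n + 1 \<Longrightarrow> norm (b k - unit_part e (p k)) < \<epsilon>"
      and b_inv: "is_invertible (\<Sum>k<n + 1. b k * b k)"
      using Lg_sa_dense_obtain[where a = "\<lambda>k. unit_part e (p k)", OF D \<epsilon> sa] by blast
    \<comment> \<open>Only a zero scalar at index 0 is moved, by \<open>\<epsilon> / 2\<close>; one
      nonzero entry suffices.\<close>
    define c where "c k = (if k = 0 \<and> scalar_part (p 0) = 0 then \<epsilon> / 2 else Re (scalar_part (p k)))"
      for k :: nat
    have real: "scalar_part (p k) = complex_of_real (Re (scalar_part (p k)))" if "k < n + 1" for k
      using arg_cong[OF p[OF that], of scalar_part] by (simp add: star_unitization_def complex_eq_iff)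
    have c0: "c 0 \<noteq> 0" using real[of 0] \<epsilon> by (auto simp: c_def)
    have c: "cmod (complex_of_real (c k) - scalar_part (p k)) < \<epsilon>" if "k < n + 1" for k
      using \<epsilon> real[OF that] by (cases "k = 0 \<and> scalar_part (p 0) = 0") (auto simp: c_def)
    have "\<exists>q. unit_part e q = b k \<and> scalar_part q = complex_of_real (c k)" for k
      using unitization_cases_unit_part by metis
    then obtain q where q: "\<And>k. unit_part e (q k) = b k"
      "\<And>k. scalar_part (q k) = complex_of_real (c k)" by metis
    have "star (q k) = q k" if "k < n + 1" for k
      unfolding unitization_eq_iff unit_part_star by (simp add: q b(1)[OF that] star_unitization_def)
    moreover have "norm (q k - p k) < \<epsilon>" if "k < n + 1" for k
      unfolding norm_unit_part unit_part_diff using b(2)[OF that] c[OF that]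
      by (simp add: q minus_unitization_def)
    moreover have "scalar_part (\<Sum>k<n + 1. q k * q k) \<noteq> 0"
    proof -
      have scalar_sum: "scalar_part (\<Sum>k\<in>A. q k * q k) = complex_of_real (\<Sum>k\<in>A. c k * c k)"
        for A :: "nat set"
        by (induction A rule: infinite_finite_induct)
          (simp_all add: zero_unitization_def plus_unitization_def times_unitization_def q)
      have "0 < (\<Sum>k<n + 1. c k * c k)"
        using c0 by (intro sum_pos2[of _ 0]) (auto simp: zero_less_mult_iff)
      then show ?thesis unfolding scalar_sum of_real_eq_0_iff by linarith
    qed
    then have "is_invertible (\<Sum>k<n + 1. q k * q k)"
      using b_inv by (simp only: is_invertible_unitization_iff unit_part_sum unit_part_mult q) simp
    ultimately show "\<exists>b. (\<forall>k<n + 1. star (b k) = b k \<and> norm (b k - p k) < \<epsilon>) \<and>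
        is_invertible (\<Sum>k<n + 1. b k * b k)"
      by (intro exI[of _ q]) simp
  qed
qed

end

section \<open>Reduction to unitizations and the rank inequalities\<close>

lemma real_rank_eq_unitization:
  "real_rank TYPE('a::cstar_algebra) = real_rank_unital TYPE('a unitization)"
proof (cases "unital TYPE('a)")
  case True
  then obtain e :: 'a where "is_identity e" by (auto simp: unital_def)
  then show ?thesis
    using True by (simp only: real_rank_def real_rank_unital_def Lg_sa_dense_unitization_iff if_True)
qed (simp add: real_rank_def)

lemma real_rank_unital_le: "Lg_sa_dense A (n + 1) \<Longrightarrow> real_rank_unital A \<le> enat n"
  by (auto simp: real_rank_unital_def intro: Least_le)

lemma real_rank_unital_eq_enat: "real_rank_unital A = enat n \<Longrightarrow> Lg_sa_dense A (n + 1)"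
  using LeastI_ex[of "\<lambda>n. Lg_sa_dense A (n + 1)"]
  by (auto simp: real_rank_unital_def split: if_splits)

theorem theorem1:
  fixes \<iota> :: "'a::cstar_algebra \<Rightarrow> 'e::cstar_algebra"
    and \<pi> :: "'e \<Rightarrow> 'b::cstar_algebra"
  assumes "cstar_extension \<iota> \<pi>"
  shows "max (real_rank TYPE('a)) (real_rank TYPE('b)) \<le> real_rank TYPE('e) \<and>
         real_rank TYPE('e) \<le> real_rank TYPE('a) + real_rank TYPE('b) + 1"
proof -
  interpret scalar_extension "map_algebra_part \<iota>" "map_algebra_part \<pi>"
    by (rule scalar_extension_unitization[OF assms])
  have lower: "real_rank TYPE('a) \<le> enat n \<and> real_rank TYPE('b) \<le> enat n"
    if "real_rank TYPE('e) = enat n" for n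
    using real_rank_unital_eq_enat[of "TYPE('e unitization)" n] that
      Lg_sa_dense_ideal Lg_sa_dense_quotient
    by (auto simp only: real_rank_eq_unitization intro!: real_rank_unital_le)
  have upper: "real_rank TYPE('e) \<le> enat m + enat n + 1"
    if "real_rank TYPE('a) = enat m" "real_rank TYPE('b) = enat n" for m n
  proof -
    \<comment> \<open>Ranks \<open>m\<close> and \<open>n\<close> mean tuples of lengths
      \<open>m + 1\<close> and \<open>n + 1\<close>; their concatenation has length
      \<open>(m + n + 1) + 1\<close>, the source of the summand 1 in the bound.\<close>
    have "Lg_sa_dense TYPE('e unitization) ((n + 1) + (m + 1))"
      using that unfolding real_rank_eq_unitization
      by (intro Lg_sa_dense_extension real_rank_unital_eq_enat)
    then have "Lg_sa_dense TYPE('e unitization) ((m + n + 1) + 1)" by (simp add: add.commute)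
    then have "real_rank TYPE('e) \<le> enat (m + n + 1)"
      unfolding real_rank_eq_unitization by (rule real_rank_unital_le)
    then show ?thesis by (simp add: one_enat_def)
  qed
  show ?thesis
  proof
    show "max (real_rank TYPE('a)) (real_rank TYPE('b)) \<le> real_rank TYPE('e)"
      using lower by (cases "real_rank TYPE('e)") auto
    show "real_rank TYPE('e) \<le> real_rank TYPE('a) + real_rank TYPE('b) + 1"
      using upper by (cases "real_rank TYPE('a)"; cases "real_rank TYPE('b)") auto
  qed
qed

end
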